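(* Let $M$ and $N$ be pointed metric spaces and let $\epsilon>0$ be arbitrary. Then for every bounded linear operator $S:\mathrm{Lip}_0(M)\to \mathrm{Lip}_0(N)$ there exists a bounded linear operator $\mathfrak{S}:C(\beta\widetilde{M})\to C(\beta\widetilde{N})$ with $\|\mathfrak{S}\|\leq \|S\|+\epsilon$ such that \[ \mathfrak{S}(\Phi_M(f))=\Phi_N(S(f))\quad\text{for every } f\in \mathrm{Lip}_0(M). \] If, in addition, $S$ is a compact operator, then $\mathfrak{S}$ can be chosen to be a compact operator satisfying $\|\mathfrak{S}\|\leq \|S\|+\epsilon$ and $\mathfrak{S}(\Phi_M(f))=\Phi_N(S(f))$ for every $f\in \mathrm{Lip}_0(M)$.
   Context: A pointed metric space is a metric space $(M,d)$ with a fixed distinguished point $0\in M$. $\mathrm{Lip}_0(M)$ is the real Banach space of all Lipschitz functions $f:M\to\mathbb{R}$ with $f(0)=0$, with norm $\|f\|=\sup_{x\neq y}\frac{|f(x)-f(y)|}{d(x,y)}$. Let $\widetilde{M}=\{(x,y)\in M\times M: x\neq y\}$, equipped with a product metric (so it carries the subspace topology from $M\times M$), and let $\beta\widetilde{M}$ be its Stone-Čech compactification. For a compact Hausdorff space $K$, $C(K)$ is the Banach space of real-valued continuous functions on $K$ with the supremum norm. The de Leeuw map $\Phi_M:\mathrm{Lip}_0(M)\to C(\beta\widetilde{M})$ is the linear isometric embedding sending $f$ to the unique continuous extension to $\beta\widetilde{M}$ of the bounded continuous function $\widetilde{M}\ni(x,y)\mapsto \frac{f(x)-f(y)}{d(x,y)}$.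 The same notation is used for $N$. *)

theory Defs
  imports "HOL-Analysis.Analysis"
begin

section \<open>The space of Lipschitz functions vanishing at the base point\<close>

class pointed_metric_space = metric_space +
  fixes basepoint :: 'a

typedef (overloaded) 'a lip0 =
  "{f :: 'a::pointed_metric_space \<Rightarrow> real. (\<exists>C. C-lipschitz_on UNIV f) \<and> f basepoint = 0}"
  morphisms apply_lip0 Abs_lip0
  by (rule exI[of _ "\<lambda>_. 0"]) (auto intro!: exI[of _ 0] lipschitz_intros)

setup_lifting type_definition_lip0

declare [[coercion "apply_lip0 :: 'a::pointed_metric_space lip0 \<Rightarrow> 'a \<Rightarrow> real"]]

lemma lip0_eqI: "(\<And>x. apply_lip0 f x = apply_lip0 g x) \<Longrightarrow> f = g"
  by transfer auto

lemma lip0_lipschitz: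
  fixes f :: "'a::pointed_metric_space lip0"
  obtains C where "0 \<le> C" "\<And>x y. \<bar>f x - f y\<bar> \<le> C * dist x y"
proof -
  obtain C where "C-lipschitz_on UNIV (apply_lip0 f)"
    using apply_lip0[of f] by auto
  then show ?thesis
    using that[of C] by (auto simp: lipschitz_on_def dist_real_def)
qed

lemma apply_lip0_basepoint [simp]: "apply_lip0 f basepoint = 0"
  by transfer simp

instantiation lip0 :: (pointed_metric_space) real_vector
begin

lift_definition zero_lip0 :: "'a lip0" is "\<lambda>_. 0"
  by (auto intro!: exI[of _ 0] lipschitz_intros)

lift_definition plus_lip0 :: "'a lip0 \<Rightarrow> 'a lip0 \<Rightarrow> 'a lip0" is "\<lambda>f g x. f x + g x"
  by (auto intro!: lipschitz_intros)

lift_definition minus_lip0 :: "'a lip0 \<Rightarrow> 'a lip0 \<Rightarrow> 'a lip0" is "\<lambda>f g x. f x - g x"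
  by (auto intro!: lipschitz_intros)

lift_definition uminus_lip0 :: "'a lip0 \<Rightarrow> 'a lip0" is "\<lambda>f x. - f x"
  by (auto intro!: lipschitz_intros)

lift_definition scaleR_lip0 :: "real \<Rightarrow> 'a lip0 \<Rightarrow> 'a lip0" is "\<lambda>a f x. a * f x"
  by (auto intro!: lipschitz_on_cmult_real)

instance
  by standard (transfer; auto simp: algebra_simps)+

end

lemmas [simp] = zero_lip0.rep_eq plus_lip0.rep_eq minus_lip0.rep_eq uminus_lip0.rep_eq
  scaleR_lip0.rep_eq

instantiation lip0 :: (pointed_metric_space) real_normed_vector
begin

text \<open>The value 0 is inserted so that the supremum is the intended one (namely 0) when the
  underlying space has just one point; it changes nothing otherwise.\<close>

definition norm_lip0 :: "'a lip0 \<Rightarrow> real" where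
  "norm_lip0 f = Sup (insert 0 {\<bar>f x - f y\<bar> / dist x y | x y. x \<noteq> y})"

definition sgn_lip0 :: "'a lip0 \<Rightarrow> 'a lip0" where
  "sgn_lip0 f = f /\<^sub>R norm f"

definition dist_lip0 :: "'a lip0 \<Rightarrow> 'a lip0 \<Rightarrow> real" where
  "dist_lip0 f g = norm (f - g)"

definition uniformity_lip0 :: "('a lip0 \<times> 'a lip0) filter" where
  "uniformity_lip0 = (INF e\<in>{0 <..}. principal {(x, y). dist x y < e})"

definition open_lip0 :: "'a lip0 set \<Rightarrow> bool" where
  "open_lip0 S = (\<forall>x\<in>S. \<forall>\<^sub>F (x', y) in uniformity. x' = x \<longrightarrow> y \<in> S)"

lemma lip0_bdd_above:
  fixes f :: "'a lip0"
  shows "bdd_above (insert 0 {\<bar>f x - f y\<bar> / dist x y | x y. x \<noteq> y})"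
proof -
  obtain C where "0 \<le> C" "\<And>x y. \<bar>f x - f y\<bar> \<le> C * dist x y"
    using lip0_lipschitz[of f] by blast
  then show ?thesis
    by (intro bdd_aboveI[of _ C]) (auto simp: divide_le_eq)
qed

lemma norm_lip0_nonneg: "0 \<le> norm (f :: 'a lip0)"
  unfolding norm_lip0_def by (rule cSup_upper[OF _ lip0_bdd_above]) simp

lemma lip0_le_norm:
  fixes f :: "'a lip0"
  shows "\<bar>f x - f y\<bar> \<le> norm f * dist x y"
proof (cases "x = y")
  case False
  then have "\<bar>f x - f y\<bar> / dist x y \<le> norm f"
    unfolding norm_lip0_def by (intro cSup_upper[OF _ lip0_bdd_above]) auto
  with False show ?thesis by (simp add: divide_le_eq)
qed simp

lemma norm_lip0_le:
  fixes f :: "'a lip0"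
  assumes "0 \<le> C" "\<And>x y. \<bar>f x - f y\<bar> \<le> C * dist x y"
  shows "norm f \<le> C"
  unfolding norm_lip0_def using assms by (intro cSup_least) (auto simp: divide_le_eq)

lemma norm_lip0_scaleR_le: "norm (a *\<^sub>R (f :: 'a lip0)) \<le> \<bar>a\<bar> * norm f"
proof (rule norm_lip0_le)
  fix x y
  have "\<bar>(a *\<^sub>R f) x - (a *\<^sub>R f) y\<bar> = \<bar>a\<bar> * \<bar>f x - f y\<bar>"
    by (simp add: abs_mult flip: right_diff_distrib)
  also have "\<dots> \<le> \<bar>a\<bar> * (norm f * dist x y)"
    by (intro mult_left_mono lip0_le_norm) simp
  finally show "\<bar>(a *\<^sub>R f) x - (a *\<^sub>R f) y\<bar> \<le> \<bar>a\<bar> * norm f * dist x y"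
    by (simp add: mult.assoc)
qed (simp add: norm_lip0_nonneg)

instance
proof
  fix f g :: "'a lip0" and a :: real
  show "norm f = 0 \<longleftrightarrow> f = 0"
  proof
    assume n: "norm f = 0"
    show "f = 0"
    proof (rule lip0_eqI)
      fix x show "apply_lip0 f x = apply_lip0 0 x"
        using lip0_le_norm[of f x basepoint] n by simp
    qed
  next
    assume "f = 0"
    then show "norm f = 0"
      using norm_lip0_le[of 0 f] norm_lip0_nonneg[of f] by simp
  qed
  show "norm (f + g) \<le> norm f + norm g"
  proof (rule norm_lip0_le)
    fix x y
    show "\<bar>(f + g) x - (f + g) y\<bar> \<le> (norm f + norm g) * dist x y"
      using lip0_le_norm[of f x y] lip0_le_norm[of g x y] by (simp add: distrib_right)
  qed (simp add: norm_lip0_nonneg)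
  show "norm (a *\<^sub>R f) = \<bar>a\<bar> * norm f"
  proof (cases "a = 0")
    case True
    then show ?thesis
      using norm_lip0_scaleR_le[of a f] norm_lip0_nonneg[of "a *\<^sub>R f"] by simp
  next
    case False
    have "\<bar>a\<bar> * norm (inverse a *\<^sub>R a *\<^sub>R f) \<le> \<bar>a\<bar> * (\<bar>inverse a\<bar> * norm (a *\<^sub>R f))"
      by (intro mult_left_mono norm_lip0_scaleR_le) simp
    then have "\<bar>a\<bar> * norm f \<le> norm (a *\<^sub>R f)"
      using False by (simp flip: mult.assoc abs_mult)
    with norm_lip0_scaleR_le[of a f] show ?thesis by simp
  qed
qed (simp_all add: sgn_lip0_def dist_lip0_def uniformity_lip0_def open_lip0_def)

end


section \<open>The Stone-Cech compactification\<close>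

text \<open>The closure of the canonical image of \<open>X\<close> in the product of real lines indexed by the
  bounded continuous functions on \<open>X\<close>.\<close>

definition bounded_continuous_maps :: "'a topology \<Rightarrow> ('a \<Rightarrow> real) set" where
  "bounded_continuous_maps X =
     {h. continuous_map X euclideanreal h \<and> bounded (h ` topspace X)}"

definition stone_cech_embed :: "'a topology \<Rightarrow> 'a \<Rightarrow> (('a \<Rightarrow> real) \<Rightarrow> real)" where
  "stone_cech_embed X x = (\<lambda>h\<in>bounded_continuous_maps X. h x)"

definition stone_cech :: "'a topology \<Rightarrow> (('a \<Rightarrow> real) \<Rightarrow> real) topology" where
  "stone_cech X =
     subtopology (powertop_real (bounded_continuous_maps X))
       (powertop_real (bounded_continuous_maps X) closure_of (stone_cech_embed X ` topspace X))"

lemma continuous_map_stone_cech_eval: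
  assumes "h \<in> bounded_continuous_maps X"
  shows "continuous_map (stone_cech X) euclideanreal (\<lambda>\<xi>. \<xi> h)"
  unfolding stone_cech_def using assms
  by (intro continuous_map_from_subtopology continuous_map_product_projection)

lemma stone_cech_embed_in_powertop:
  "stone_cech_embed X ` topspace X \<subseteq> topspace (powertop_real (bounded_continuous_maps X))"
  by (auto simp: stone_cech_embed_def)

lemma topspace_stone_cech:
  "topspace (stone_cech X) =
     powertop_real (bounded_continuous_maps X) closure_of (stone_cech_embed X ` topspace X)"
  unfolding stone_cech_def using closure_of_subset_topspace by fastforce

lemma stone_cech_embed_in: "x \<in> topspace X \<Longrightarrow> stone_cech_embed X x \<in> topspace (stone_cech X)"
  unfolding topspace_stone_cech
  using closure_of_subset[OF stone_cech_embed_in_powertop[of X]] by blast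

lemma stone_cech_embed_dense:
  "stone_cech X closure_of (stone_cech_embed X ` topspace X) = topspace (stone_cech X)"
proof -
  have "stone_cech_embed X ` topspace X \<subseteq> topspace (stone_cech X)"
    using stone_cech_embed_in by auto
  then show ?thesis
    unfolding topspace_stone_cech
    by (simp add: stone_cech_def closure_of_subtopology Int_absorb1)
qed

lemma Hausdorff_space_stone_cech: "Hausdorff_space (stone_cech X)"
  unfolding stone_cech_def
  by (simp add: Hausdorff_space_subtopology Hausdorff_space_product_topology)

lemma compact_space_stone_cech: "compact_space (stone_cech X)"
proof -
  let ?B = "bounded_continuous_maps X" and ?e = "stone_cech_embed X"
  let ?P = "PiE ?B (\<lambda>h. closure (h ` topspace X))"
  have "compactin (powertop_real ?B) ?P"
    by (auto simp: compactin_PiE bounded_continuous_maps_def compact_closure)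
  moreover have "closedin (powertop_real ?B) ?P"
    by (auto simp: closedin_product_topology)
  moreover have "?e ` topspace X \<subseteq> ?P"
    using closure_subset by (fastforce simp: stone_cech_embed_def)
  ultimately have "compactin (powertop_real ?B) (powertop_real ?B closure_of (?e ` topspace X))"
    by (meson closed_compactin closedin_closure_of closure_of_minimal)
  then show ?thesis
    by (simp add: stone_cech_def compact_space_subtopology)
qed

lemma embedding_map_stone_cech:
  assumes "completely_regular_space X" "Hausdorff_space X"
  shows "embedding_map X (stone_cech X) (stone_cech_embed X)"
proof -
  let ?B = "bounded_continuous_maps X" and ?e = "stone_cech_embed X"
  have cont: "continuous_map X (stone_cech X) ?e"
    unfolding stone_cech_def continuous_map_in_subtopology
  proof (intro conjI)
    show "continuous_map X (powertop_real ?B) ?e"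
      unfolding continuous_map_componentwise
    proof (intro conjI ballI)
      show "?e ` topspace X \<subseteq> extensional ?B"
        by (auto simp: stone_cech_embed_def)
      fix h assume "h \<in> ?B"
      then show "continuous_map X euclideanreal (\<lambda>x. ?e x h)"
        by (simp add: stone_cech_embed_def) (simp add: bounded_continuous_maps_def)
    qed
    show "?e \<in> topspace X \<rightarrow> powertop_real ?B closure_of ?e ` topspace X"
      using stone_cech_embed_in[of _ X] unfolding topspace_stone_cech by (rule Pi_I)
  qed
  have sep: "\<exists>h\<in>?B. h x = 0 \<and> h ` S \<subseteq> {1}"
    if S: "closedin X S" "x \<in> topspace X - S" for S x
  proof -
    obtain h where h: "continuous_map X (top_of_set {0..1::real}) h" "h x = 0" "h ` S \<subseteq> {1}"
      using assms(1) S unfolding completely_regular_space_def by metis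
    then have "h ` topspace X \<subseteq> {0..1}"
      by (auto simp: continuous_map_in_subtopology)
    then have "bounded (h ` topspace X)"
      using bounded_closed_interval bounded_subset by blast
    with h show ?thesis
      by (auto simp: bounded_continuous_maps_def continuous_map_in_subtopology)
  qed
  have inj: "inj_on ?e (topspace X)"
  proof (rule inj_onI, rule ccontr)
    fix x y assume xy: "x \<in> topspace X" "y \<in> topspace X" "?e x = ?e y" "x \<noteq> y"
    then have "closedin X {y}" "x \<in> topspace X - {y}"
      using assms(2) closedin_Hausdorff_singleton by auto
    from sep[OF this] obtain h where "h \<in> ?B" "h x = 0" "h y = 1" by auto
    with xy(3) show False
      by (metis restrict_apply' stone_cech_embed_def zero_neq_one)
  qed
  have "open_map X (subtopology (stone_cech X) (?e ` topspace X)) ?e"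
    unfolding open_map_def
  proof (intro allI impI)
    fix U assume U: "openin X U"
    show "openin (subtopology (stone_cech X) (?e ` topspace X)) (?e ` U)"
    proof (subst openin_subopen, clarify)
      fix x assume x: "x \<in> U"
      have "closedin X (topspace X - U)" "x \<in> topspace X - (topspace X - U)"
        using U x openin_subset by auto
      from sep[OF this] obtain h where h: "h \<in> ?B" "h x = 0" "h ` (topspace X - U) \<subseteq> {1}" by auto
      let ?W = "{\<xi> \<in> topspace (stone_cech X). \<xi> h \<in> {..<1}} \<inter> ?e ` topspace X"
      have "openin (stone_cech X) {\<xi> \<in> topspace (stone_cech X). \<xi> h \<in> {..<1}}"
        by (rule openin_continuous_map_preimage[OF continuous_map_stone_cech_eval[OF h(1)]]) simp
      then have "openin (subtopology (stone_cech X) (?e ` topspace X)) ?W"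
        by (auto simp: openin_subtopology)
      moreover have "x \<in> topspace X" using U x openin_subset by blast
      then have "?e x \<in> ?W"
        using h stone_cech_embed_in by (auto simp: stone_cech_embed_def)
      moreover have "?W \<subseteq> ?e ` U"
        using h by (fastforce simp: stone_cech_embed_def)
      ultimately show "\<exists>T. openin (subtopology (stone_cech X) (?e ` topspace X)) T \<and>
          ?e x \<in> T \<and> T \<subseteq> ?e ` U"
        by blast
    qed
  qed
  moreover have "continuous_map X (subtopology (stone_cech X) (?e ` topspace X)) ?e"
    using cont by (simp add: continuous_map_in_subtopology)
  moreover have "?e ` topspace X = topspace (subtopology (stone_cech X) (?e ` topspace X))"
    using stone_cech_embed_in by auto
  ultimately show ?thesis
    using inj unfolding embedding_map_def by (intro bijective_open_imp_homeomorphic_map)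
qed


section \<open>Continuous functions on the compactification of the off-diagonal\<close>

definition offdiag :: "('a::metric_space \<times> 'a) topology" where
  "offdiag = top_of_set {(x, y). x \<noteq> y}"

lemma topspace_offdiag [simp]: "topspace offdiag = {(x, y). x \<noteq> y}"
  by (simp add: offdiag_def)

lemma offdiag_Tychonoff: "completely_regular_space offdiag" "Hausdorff_space offdiag"
  by (auto simp: offdiag_def metrizable_space_euclidean metrizable_space_subtopology
      Hausdorff_space_subtopology intro!: metrizable_imp_completely_regular_space)

text \<open>An element of \<open>'a cbeta\<close> is a continuous real function on the compactification
  of \<open>offdiag\<close>, represented by its extension by 0 to the ambient type. The compactification is
  kept as a topology, not a type, because it is empty over a one-point space; then
  \<open>'a cbeta\<close> is the zero space.\<close>

typedef (overloaded) 'a cbeta =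
  "{F :: (('a::metric_space \<times> 'a \<Rightarrow> real) \<Rightarrow> real) \<Rightarrow> real.
      continuous_map (stone_cech offdiag) euclideanreal F \<and>
      (\<forall>\<xi>. \<xi> \<notin> topspace (stone_cech offdiag) \<longrightarrow> F \<xi> = 0)}"
  morphisms apply_cbeta Abs_cbeta
  by (rule exI[of _ "\<lambda>_. 0"]) auto

setup_lifting type_definition_cbeta

declare [[coercion
  "apply_cbeta :: 'a::metric_space cbeta \<Rightarrow> (('a \<times> 'a \<Rightarrow> real) \<Rightarrow> real) \<Rightarrow> real"]]

lemma apply_cbeta_continuous: "continuous_map (stone_cech offdiag) euclideanreal (apply_cbeta F)"
  using apply_cbeta[of F] by (rule CollectE) (rule conjunct1)

lemma apply_cbeta_outside: "\<xi> \<notin> topspace (stone_cech offdiag) \<Longrightarrow> apply_cbeta F \<xi> = 0"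
  using apply_cbeta[of F] by (rule CollectE) blast

lemma cbeta_eqI:
  assumes "\<And>\<xi>. \<xi> \<in> topspace (stone_cech offdiag) \<Longrightarrow> apply_cbeta F \<xi> = apply_cbeta G \<xi>"
  shows "F = G"
proof -
  have "apply_cbeta F \<xi> = apply_cbeta G \<xi>" for \<xi>
    by (cases "\<xi> \<in> topspace (stone_cech offdiag)") (simp_all add: assms apply_cbeta_outside)
  then show ?thesis
    by (simp add: fun_eq_iff flip: apply_cbeta_inject)
qed

lemma cbeta_eqI_dense:
  assumes "\<And>x y. x \<noteq> y \<Longrightarrow>
    apply_cbeta F (stone_cech_embed offdiag (x, y)) = apply_cbeta G (stone_cech_embed offdiag (x, y))"
  shows "F = G"
proof (rule cbeta_eqI)
  fix \<xi> :: "('a \<times> 'a \<Rightarrow> real) \<Rightarrow> real"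
  assume "\<xi> \<in> topspace (stone_cech offdiag)"
  then have \<xi>: "\<xi> \<in> stone_cech offdiag closure_of (stone_cech_embed offdiag ` topspace offdiag)"
    unfolding stone_cech_embed_dense .
  have eq: "apply_cbeta F \<eta> = apply_cbeta G \<eta>"
    if "\<eta> \<in> stone_cech_embed offdiag ` topspace offdiag" for \<eta>
    using that by (clarsimp simp: assms)
  show "apply_cbeta F \<xi> = apply_cbeta G \<xi>"
    by (rule forall_in_closure_of_eq[OF \<xi> Hausdorff_space_euclidean apply_cbeta_continuous apply_cbeta_continuous eq])
qed

instantiation cbeta :: (metric_space) real_vector
begin

lift_definition zero_cbeta :: "'a cbeta" is "\<lambda>_. 0"
  by simp

lift_definition plus_cbeta :: "'a cbeta \<Rightarrow> 'a cbeta \<Rightarrow> 'a cbeta" is "\<lambda>F G \<xi>. F \<xi> + G \<xi>"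
  by (auto intro!: continuous_map_add)

lift_definition minus_cbeta :: "'a cbeta \<Rightarrow> 'a cbeta \<Rightarrow> 'a cbeta" is "\<lambda>F G \<xi>. F \<xi> - G \<xi>"
  by (auto intro!: continuous_map_diff)

lift_definition uminus_cbeta :: "'a cbeta \<Rightarrow> 'a cbeta" is "\<lambda>F \<xi>. - F \<xi>"
  by (auto intro!: continuous_map_minus)

lift_definition scaleR_cbeta :: "real \<Rightarrow> 'a cbeta \<Rightarrow> 'a cbeta" is "\<lambda>a F \<xi>. a * F \<xi>"
  by (auto intro!: continuous_map_real_mult_left)

instance
  by standard (transfer; auto simp: algebra_simps)+

end

lemmas [simp] = zero_cbeta.rep_eq plus_cbeta.rep_eq minus_cbeta.rep_eq uminus_cbeta.rep_eq
  scaleR_cbeta.rep_eq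

instantiation cbeta :: (metric_space) real_normed_vector
begin

definition norm_cbeta :: "'a cbeta \<Rightarrow> real" where
  "norm_cbeta F = Sup (insert 0 {\<bar>F \<xi>\<bar> | \<xi>. \<xi> \<in> topspace (stone_cech offdiag)})"

definition sgn_cbeta :: "'a cbeta \<Rightarrow> 'a cbeta" where
  "sgn_cbeta F = F /\<^sub>R norm F"

definition dist_cbeta :: "'a cbeta \<Rightarrow> 'a cbeta \<Rightarrow> real" where
  "dist_cbeta F G = norm (F - G)"

definition uniformity_cbeta :: "('a cbeta \<times> 'a cbeta) filter" where
  "uniformity_cbeta = (INF e\<in>{0 <..}. principal {(x, y). dist x y < e})"

definition open_cbeta :: "'a cbeta set \<Rightarrow> bool" where
  "open_cbeta S = (\<forall>x\<in>S. \<forall>\<^sub>F (x', y) in uniformity. x' = x \<longrightarrow> y \<in> S)"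

lemma cbeta_bdd_above:
  fixes F :: "'a cbeta"
  shows "bdd_above (insert 0 {\<bar>F \<xi>\<bar> | \<xi>. \<xi> \<in> topspace (stone_cech offdiag)})"
proof -
  have "compactin euclideanreal (apply_cbeta F ` topspace (stone_cech offdiag))"
    by (rule image_compactin[OF _ apply_cbeta_continuous])
      (use compact_space_stone_cech in \<open>simp add: compact_space_def\<close>)
  then have "bounded (apply_cbeta F ` topspace (stone_cech offdiag))"
    by (simp add: compact_imp_bounded)
  then obtain B where "\<And>\<xi>. \<xi> \<in> topspace (stone_cech offdiag) \<Longrightarrow> \<bar>F \<xi>\<bar> \<le> B"
    by (auto simp: bounded_iff)
  then show ?thesis
    by (intro bdd_aboveI[of _ "max 0 B"]) (auto simp: le_max_iff_disj)
qed

lemma norm_cbeta_nonneg: "0 \<le> norm (F :: 'a cbeta)"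
  unfolding norm_cbeta_def by (rule cSup_upper[OF _ cbeta_bdd_above]) simp

lemma cbeta_le_norm:
  fixes F :: "'a cbeta"
  shows "\<bar>F \<xi>\<bar> \<le> norm F"
proof (cases "\<xi> \<in> topspace (stone_cech offdiag)")
  case True
  then show ?thesis
    unfolding norm_cbeta_def by (intro cSup_upper[OF _ cbeta_bdd_above]) auto
next
  case False
  then have "F \<xi> = 0" by (rule apply_cbeta_outside)
  then show ?thesis by (simp add: norm_cbeta_nonneg)
qed

lemma norm_cbeta_le:
  fixes F :: "'a cbeta"
  assumes "0 \<le> C" "\<And>\<xi>. \<xi> \<in> topspace (stone_cech offdiag) \<Longrightarrow> \<bar>F \<xi>\<bar> \<le> C"
  shows "norm F \<le> C"
  unfolding norm_cbeta_def using assms by (intro cSup_least) auto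

lemma norm_cbeta_scaleR_le: "norm (a *\<^sub>R (F :: 'a cbeta)) \<le> \<bar>a\<bar> * norm F"
  by (rule norm_cbeta_le)
    (simp_all add: norm_cbeta_nonneg abs_mult mult_left_mono cbeta_le_norm)

instance
proof
  fix F G :: "'a cbeta" and a :: real
  show "norm F = 0 \<longleftrightarrow> F = 0"
  proof
    assume n: "norm F = 0"
    show "F = 0"
    proof (rule cbeta_eqI)
      fix \<xi> show "apply_cbeta F \<xi> = apply_cbeta 0 \<xi>"
        using cbeta_le_norm[of F \<xi>] n by simp
    qed
  next
    assume "F = 0"
    then show "norm F = 0"
      using norm_cbeta_le[of 0 F] norm_cbeta_nonneg[of F] by simp
  qed
  show "norm (F + G) \<le> norm F + norm G"
  proof (rule norm_cbeta_le)
    fix \<xi>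
    show "\<bar>(F + G) \<xi>\<bar> \<le> norm F + norm G"
      using cbeta_le_norm[of F \<xi>] cbeta_le_norm[of G \<xi>] by simp
  qed (simp add: norm_cbeta_nonneg)
  show "norm (a *\<^sub>R F) = \<bar>a\<bar> * norm F"
  proof (cases "a = 0")
    case True
    then show ?thesis
      using norm_cbeta_scaleR_le[of a F] norm_cbeta_nonneg[of "a *\<^sub>R F"] by simp
  next
    case False
    have "\<bar>a\<bar> * norm (inverse a *\<^sub>R a *\<^sub>R F) \<le> \<bar>a\<bar> * (\<bar>inverse a\<bar> * norm (a *\<^sub>R F))"
      by (intro mult_left_mono norm_cbeta_scaleR_le) simp
    then have "\<bar>a\<bar> * norm F \<le> norm (a *\<^sub>R F)"
      using False by (simp flip: mult.assoc abs_mult)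
    with norm_cbeta_scaleR_le[of a F] show ?thesis by simp
  qed
qed (simp_all add: sgn_cbeta_def dist_cbeta_def uniformity_cbeta_def open_cbeta_def)

end


section \<open>The de Leeuw map and compact operators\<close>

definition de_leeuw :: "'a::pointed_metric_space lip0 \<Rightarrow> 'a cbeta" where
  "de_leeuw f =
     (THE F. \<forall>x y. x \<noteq> y \<longrightarrow>
        apply_cbeta F (stone_cech_embed offdiag (x, y)) = (f x - f y) / dist x y)"

lemma lip0_quotient_bounded_continuous:
  fixes f :: "'a::pointed_metric_space lip0"
  shows "(\<lambda>(x, y). (f x - f y) / dist x y) \<in> bounded_continuous_maps offdiag"
proof -
  obtain C where "C-lipschitz_on UNIV (apply_lip0 f)"
    using apply_lip0[of f] by auto
  then have f: "continuous_on UNIV (apply_lip0 f)"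
    by (rule lipschitz_on_continuous_on)
  have "continuous_on {(x, y). x \<noteq> y} (\<lambda>p. f (fst p))"
    by (rule continuous_on_compose2[OF f]) (simp_all add: continuous_on_fst)
  moreover have "continuous_on {(x, y). x \<noteq> y} (\<lambda>p. f (snd p))"
    by (rule continuous_on_compose2[OF f]) (simp_all add: continuous_on_snd)
  ultimately have
    "continuous_on {(x, y). x \<noteq> y} (\<lambda>p. (f (fst p) - f (snd p)) / dist (fst p) (snd p))"
    by (intro continuous_on_divide continuous_on_diff continuous_on_dist continuous_on_fst
        continuous_on_snd continuous_on_id) auto
  moreover have "bounded ((\<lambda>p. (f (fst p) - f (snd p)) / dist (fst p) (snd p)) ` {(x, y). x \<noteq> y})"
    by (rule boundedI[of _ "norm f"]) (auto simp: abs_divide divide_le_eq lip0_le_norm)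
  ultimately show ?thesis
    by (simp add: bounded_continuous_maps_def offdiag_def case_prod_unfold)
qed

lemma de_leeuw_embed:
  fixes f :: "'a::pointed_metric_space lip0"
  assumes "x \<noteq> y"
  shows "apply_cbeta (de_leeuw f) (stone_cech_embed offdiag (x, y)) = (f x - f y) / dist x y"
proof -
  let ?q = "\<lambda>(x, y). (f x - f y) / dist x y"
  let ?K = "topspace (stone_cech (offdiag :: ('a \<times> 'a) topology))"
  let ?P = "\<lambda>F. \<forall>x y. x \<noteq> y \<longrightarrow>
    apply_cbeta F (stone_cech_embed offdiag (x, y)) = (f x - f y) / dist x y"
  have q: "?q \<in> bounded_continuous_maps offdiag"
    by (rule lip0_quotient_bounded_continuous)
  define F where "F = Abs_cbeta (\<lambda>\<xi>. if \<xi> \<in> ?K then \<xi> ?q else 0)"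
  have "continuous_map (stone_cech offdiag) euclideanreal (\<lambda>\<xi>. if \<xi> \<in> ?K then \<xi> ?q else 0)"
    by (rule continuous_map_eq[OF continuous_map_stone_cech_eval[OF q]]) simp
  then have F: "apply_cbeta F = (\<lambda>\<xi>. if \<xi> \<in> ?K then \<xi> ?q else 0)"
    unfolding F_def by (intro Abs_cbeta_inverse) simp
  have "?P F"
  proof (intro allI impI)
    fix x y :: 'a assume "x \<noteq> y"
    then have "stone_cech_embed offdiag (x, y) \<in> ?K"
      by (intro stone_cech_embed_in) simp
    then show "apply_cbeta F (stone_cech_embed offdiag (x, y)) = (f x - f y) / dist x y"
      using q by (simp add: F stone_cech_embed_def)
  qed
  moreover have "G = F" if "?P G" for G
    by (rule cbeta_eqI_dense) (use that \<open>?P F\<close> in simp)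
  ultimately have "?P (de_leeuw f)"
    unfolding de_leeuw_def by (rule theI)
  with assms show ?thesis by blast
qed

definition compact_operator :: "('a::real_normed_vector \<Rightarrow> 'b::real_normed_vector) \<Rightarrow> bool" where
  "compact_operator T \<longleftrightarrow> bounded_linear T \<and> (\<forall>B. bounded B \<longrightarrow> compact (closure (T ` B)))"

end

theory Submission
  imports Defs
begin

text \<open>For \<open>p = (x, y)\<close> let \<open>m p\<close> be the functional \<open>f \<mapsto> (f x - f y) / d(x, y)\<close> on \<open>Lip\<^sub>0(N)\<close>; it is
  norm continuous in \<open>p\<close>. Extending \<open>S\<close> amounts to lifting the functionals \<open>m p \<circ> S\<close> along the
  restriction map \<open>C(\<beta>M)\<^sup>* \<rightarrow> Lip\<^sub>0(M)\<^sup>*\<close> so that the lift \<open>\<psi> p\<close> is norm continuous in \<open>p\<close>, and then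
  extending \<open>p \<mapsto> \<psi> p G\<close> to \<open>\<beta>N\<close>. Pointwise lifts come from Hahn--Banach, and the Bartle--Graves
  theorem provides a continuous choice with norms increased by at most \<open>\<epsilon>\<close>. If \<open>S\<close> is compact, then the
  functionals \<open>m p \<circ> S\<close> form a totally bounded set; continuity keeps their lifts in a compact set,
  and so the extension is compact.\<close>

section \<open>Bartle--Graves selections\<close>

text \<open>Adding \<open>c\<close> to either supremum bounds the other family. This passes a common
  Lipschitz constant from the bumps \<open>f b\<close> on to their suprema
  \<open>F a\<close>.\<close>

lemma abs_cSup_image_diff_le:
  fixes f g :: "'i \<Rightarrow> real"
  assumes "I \<noteq> {}" "bdd_above (f ` I)" "bdd_above (g ` I)" "\<And>i. i \<in> I \<Longrightarrow> \<bar>f i - g i\<bar> \<le> c"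
  shows "\<bar>Sup (f ` I) - Sup (g ` I)\<bar> \<le> c"
proof -
  have "Sup (f ` I) \<le> Sup (g ` I) + c" if "bdd_above (g ` I)" "\<And>i. i \<in> I \<Longrightarrow> \<bar>f i - g i\<bar> \<le> c"
    for f g :: "'i \<Rightarrow> real"
  proof (rule cSUP_least[OF assms(1)])
    fix i assume i: "i \<in> I"
    then have "g i \<le> Sup (g ` I)" using that(1) by (rule cSUP_upper)
    then show "f i \<le> Sup (g ` I) + c" using that(2)[OF i] by linarith
  qed
  note le = this
  have "Sup (f ` I) \<le> Sup (g ` I) + c"
    using assms(3,4) by (rule le)
  moreover have "Sup (g ` I) \<le> Sup (f ` I) + c"
    using assms(4) by (intro le[OF assms(2)]) (simp add: abs_minus_commute)
  ultimately show ?thesis by linarith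
qed

text \<open>With bumps \<open>f a\<close> around all points \<open>a\<close> and a well-order of the points, put
  \<open>g a = (f a - sup\<^bsub>b < a\<^esub> f b)\<^sup>+\<close>. The sums of the \<open>g a\<close> telescope to the supremum of all
  \<open>f a\<close>, which is 1. No local finiteness is needed later, so paracompactness is avoided.\<close>

lemma partition_of_unity_small_supports:
  fixes \<delta> :: real
  assumes "\<delta> > 0"
  obtains g :: "'x::metric_space \<Rightarrow> 'x \<Rightarrow> real"
  where "\<And>a x. 0 \<le> g a x" "\<And>a. continuous_on UNIV (g a)"
    "\<And>a x. g a x \<noteq> 0 \<Longrightarrow> dist x a < \<delta>" "\<And>x. ((\<lambda>a. g a x) has_sum 1) UNIV"
proof -
  obtain r :: "'x rel" where r: "Well_order r" "Field r = UNIV"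
    by (metis well_ordering)
  define lt where "lt = r - Id"
  have wf: "wf lt" using r by (simp add: lt_def well_order_on_def)
  have "trans r" "antisym r" "total_on UNIV r"
    using r by (simp_all add: order_on_defs)
  then have lt_trans: "(a, c) \<in> lt" if "(a, b) \<in> lt" "(b, c) \<in> lt" for a b c
    using that unfolding lt_def by (meson trans_diff_Id transD)
  have lt_total: "(a, b) \<in> lt \<or> (b, a) \<in> lt" if "a \<noteq> b" for a b
    using that \<open>total_on UNIV r\<close> by (auto simp: lt_def total_on_def)
  have lt_irrefl: "(a, a) \<notin> lt" for a by (simp add: lt_def)
  \<comment> \<open>A cone of height 1 at \<open>a\<close> that vanishes from distance
    \<open>\<delta>\<close> on; its Lipschitz constant \<open>1 / \<delta>\<close> is the same for
    every \<open>a\<close>.\<close>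
  define f where "f a x = max 0 (1 - dist x a / \<delta>)" for a x :: 'x
  \<comment> \<open>the index \<open>None\<close> contributes 0, which makes the supremum meaningful for the least \<open>a\<close>\<close>
  define F where "F a x = Sup ((\<lambda>b. case b of None \<Rightarrow> 0 | Some b \<Rightarrow> f b x) `
    insert None (Some ` {b. (b, a) \<in> lt}))" for a x
  define g where "g a x = max 0 (f a x - F a x)" for a x
  have f01: "0 \<le> f a x" "f a x \<le> 1" for a x
    using assms by (auto simp: f_def)
  have bdd: "bdd_above ((\<lambda>b. case b of None \<Rightarrow> 0 | Some b \<Rightarrow> f b x) ` I)" for x I
    by (rule bdd_aboveI[of _ 1]) (auto simp: f01 split: option.splits)
  have f_lip: "\<bar>f a x - f a y\<bar> \<le> (1 / \<delta>) * dist x y" for a x y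
  proof -
    have "\<bar>dist x a / \<delta> - dist y a / \<delta>\<bar> \<le> (1 / \<delta>) * dist x y"
      using abs_dist_diff_le[of x a y] assms dist_commute[of a y]
      by (simp add: divide_right_mono flip: diff_divide_distrib)
    then show ?thesis unfolding f_def by linarith
  qed
  have cont: "continuous_on UNIV h" if "\<And>x y. \<bar>h x - h y\<bar> \<le> (1 / \<delta>) * dist x y"
    for h :: "'x \<Rightarrow> real"
    by (rule lipschitz_on_continuous_on[of "1 / \<delta>"], rule lipschitz_onI)
      (use that assms in \<open>auto simp: dist_real_def\<close>)
  \<comment> \<open>A supremum of functions with a common Lipschitz constant keeps that constant,
    however many bumps overlap. This stands in for local finiteness.\<close>
  have F_lip: "\<bar>F a x - F a y\<bar> \<le> (1 / \<delta>) * dist x y" for a x y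
    unfolding F_def
    by (rule abs_cSup_image_diff_le[OF _ bdd bdd]) (use f_lip assms in auto)
  have F_upper: "f b x \<le> F a x" if "(b, a) \<in> lt" for a b x
  proof -
    have "(case Some b of None \<Rightarrow> 0 | Some b \<Rightarrow> f b x) \<le> F a x"
      unfolding F_def by (rule cSUP_upper[OF _ bdd]) (use that in simp)
    then show ?thesis by simp
  qed
  have F_nonneg: "0 \<le> F a x" for a x
  proof -
    have "(case None of None \<Rightarrow> 0 | Some b \<Rightarrow> f b x) \<le> F a x"
      unfolding F_def by (rule cSUP_upper[OF _ bdd]) simp
    then show ?thesis by simp
  qed
  have F_approx: "F a x \<le> \<eta> \<or> (\<exists>b. (b, a) \<in> lt \<and> F a x < f b x + \<eta>)" if "\<eta> > 0" for a x \<eta>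
  proof -
    let ?V = "(\<lambda>b. case b of None \<Rightarrow> 0 | Some b \<Rightarrow> f b x) ` insert None (Some ` {b. (b, a) \<in> lt})"
    have "F a x - \<eta> < Sup ?V" using that by (simp add: F_def)
    then obtain z where "z \<in> ?V" "F a x - \<eta> < z"
      by (rule less_cSupE) auto
    then show ?thesis by auto
  qed
  \<comment> \<open>Peel off the greatest index \<open>m\<close> of \<open>A\<close>. The remaining
    bumps at \<open>x\<close> are at most \<open>F m x\<close>, so the induction hypothesis with
    \<open>u = F m x\<close> bounds their sum, and \<open>g m x + F m x = f m x\<close> when
    \<open>g m x\<close> is positive. Hence \<open>u\<close> is generalised in the
    induction.\<close>
  have sum_le: "finite A \<Longrightarrow> 0 \<le> u \<Longrightarrow> (\<And>a. a \<in> A \<Longrightarrow> f a x \<le> u) \<Longrightarrow> (\<Sum>a\<in>A. g a x) \<le> u"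
    for A x u
  proof (induction "card A" arbitrary: A u)
    case (Suc n)
    then have "A \<noteq> {}" by auto
    obtain m where m: "m \<in> A" "\<And>b. b \<in> A \<Longrightarrow> (m, b) \<notin> lt"
    proof -
      \<comment> \<open>Acyclic relations on a finite set have a well-founded converse; a minimal
        element of the converse is maximal in \<open>A\<close>.\<close>
      have "acyclic (lt \<inter> A \<times> A)"
        using wf by (meson Int_lower1 acyclic_subset wf_acyclic)
      moreover have "finite (lt \<inter> A \<times> A)" using \<open>finite A\<close> by simp
      ultimately have "wf ((lt \<inter> A \<times> A)\<inverse>)" by (metis finite_acyclic_wf_converse)
      then obtain m where "m \<in> A" "\<And>b. (b, m) \<in> (lt \<inter> A \<times> A)\<inverse> \<Longrightarrow> b \<notin> A"
        using \<open>A \<noteq> {}\<close> by (metis wfE_min ex_in_conv)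
      then show ?thesis using that by blast
    qed
    have sum: "(\<Sum>a\<in>A. g a x) = g m x + (\<Sum>a\<in>A - {m}. g a x)"
      using m(1) Suc.prems(1) by (rule sum.remove[rotated])
    have card: "n = card (A - {m})" "finite (A - {m})" using m(1) Suc by auto
    show ?case
    proof (cases "f m x \<le> F m x")
      case True
      then have "g m x = 0" by (simp add: g_def)
      moreover have "(\<Sum>a\<in>A - {m}. g a x) \<le> u"
        by (rule Suc.hyps(1)[OF card Suc.prems(2)]) (use Suc.prems in auto)
      ultimately show ?thesis using sum by simp
    next
      case False
      have "(\<Sum>a\<in>A - {m}. g a x) \<le> F m x"
      proof (rule Suc.hyps(1)[OF card F_nonneg])
        fix b assume "b \<in> A - {m}"
        then show "f b x \<le> F m x" using m lt_total F_upper by blast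
      qed
      with False have "(\<Sum>a\<in>A. g a x) \<le> f m x" unfolding sum by (simp add: g_def)
      then show ?thesis using Suc.prems(3)[OF m(1)] by linarith
    qed
  qed simp
  \<comment> \<open>Unless \<open>F a x\<close> is itself small, some \<open>b\<close> below
    \<open>a\<close> has \<open>f b x\<close> close to it, and by induction a finite sum of terms up
    to \<open>b\<close> almost reaches \<open>f b x\<close>. Adding
    \<open>g a x \<ge> f a x - F a x\<close> then almost reaches \<open>f a x\<close>. The tolerance
    is halved between the two approximations.\<close>
  have sum_ge: "\<eta> > 0 \<Longrightarrow> \<exists>A. finite A \<and> (\<forall>b\<in>A. b = a \<or> (b, a) \<in> lt) \<and> f a x < (\<Sum>b\<in>A. g b x) + \<eta>"
    for a x \<eta>
    using wf
  proof (induction a arbitrary: \<eta> rule: wf_induct_rule)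
    case (less a)
    have "\<exists>A. finite A \<and> (\<forall>b\<in>A. (b, a) \<in> lt) \<and> F a x < (\<Sum>b\<in>A. g b x) + \<eta>"
    proof (cases "F a x \<le> \<eta> / 2")
      case True
      then show ?thesis using less.prems by (intro exI[of _ "{}"]) auto
    next
      case False
      then obtain b where b: "(b, a) \<in> lt" "F a x < f b x + \<eta> / 2"
        using F_approx[of "\<eta> / 2" a x] less.prems by auto
      obtain A where "finite A" "\<forall>c\<in>A. c = b \<or> (c, b) \<in> lt" "f b x < (\<Sum>b\<in>A. g b x) + \<eta> / 2"
        using less.IH[OF b(1), of "\<eta> / 2"] less.prems by auto
      then show ?thesis using b lt_trans by (intro exI[of _ A]) auto
    qed
    then obtain A where A: "finite A" "\<forall>b\<in>A. (b, a) \<in> lt" "F a x < (\<Sum>b\<in>A. g b x) + \<eta>"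
      by blast
    then have "a \<notin> A" using lt_irrefl by auto
    with A show ?case
      by (intro exI[of _ "insert a A"]) (auto simp: g_def)
  qed
  have summ: "((\<lambda>a. g a x) has_sum 1) UNIV" for x
  proof -
    have le1: "(\<Sum>a\<in>A. g a x) \<le> 1" if "finite A" for A
      using that f01 by (intro sum_le) auto
    have hs: "((\<lambda>a. g a x) has_sum (SUP A\<in>{A. finite A \<and> A \<subseteq> UNIV}. \<Sum>a\<in>A. g a x)) UNIV"
      by (rule nonneg_bdd_above_has_sum) (auto simp: g_def intro!: bdd_aboveI[of _ 1] le1[unfolded g_def])
    have "(SUP A\<in>{A. finite A \<and> A \<subseteq> UNIV}. \<Sum>a\<in>A. g a x) = 1"
    proof (rule cSup_eq_non_empty)
      fix u assume u: "\<And>z. z \<in> (\<lambda>A. \<Sum>a\<in>A. g a x) ` {A. finite A \<and> A \<subseteq> UNIV} \<Longrightarrow> z \<le> u"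
      show "1 \<le> u"
      proof (rule field_le_epsilon)
        fix \<eta> :: real assume "\<eta> > 0"
        \<comment> \<open>The bump centred at \<open>x\<close> takes the value 1 at
          \<open>x\<close>.\<close>
        then obtain A where "finite A" "f x x < (\<Sum>b\<in>A. g b x) + \<eta>"
          using sum_ge by blast
        then show "1 \<le> u + \<eta>" using u[of "\<Sum>b\<in>A. g b x"] by (auto simp: f_def)
      qed
    qed (use le1 in auto)
    then show ?thesis using hs by simp
  qed
  show ?thesis
  proof (rule that[of g])
    show "continuous_on UNIV (g a)" for a
      unfolding g_def using cont[OF f_lip] cont[OF F_lip] by (intro continuous_intros)
    show "dist x a < \<delta>" if "g a x \<noteq> 0" for a x
    proof -
      have "f a x > 0" using that F_nonneg[of a x] f01(1)[of a x] unfolding g_def by (auto simp: max_def split: if_splits)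
      then show ?thesis using assms by (auto simp: f_def less_max_iff_disj)
    qed
    show "0 \<le> g a x" for a x by (simp add: g_def)
  qed (rule summ)
qed

section \<open>Infinite sums weighted by a partition of unity\<close>

lemma norm_weighted_infsum_le:
  fixes e :: "'i \<Rightarrow> 'e::banach"
  assumes w: "(w has_sum s) A" "\<And>a. a \<in> A \<Longrightarrow> 0 \<le> w a"
    and e: "\<And>a. a \<in> A \<Longrightarrow> w a \<noteq> 0 \<Longrightarrow> norm (e a) \<le> B"
  shows "(\<lambda>a. w a *\<^sub>R e a) summable_on A" "norm (\<Sum>\<^sub>\<infinity>a\<in>A. w a *\<^sub>R e a) \<le> B * s"
proof -
  \<comment> \<open>Where the weight vanishes both sides are 0, so \<open>e\<close> has to be
    bounded only where it counts.\<close>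
  have le: "norm (w a *\<^sub>R e a) \<le> B * w a" if "a \<in> A" for a
    using w(2)[OF that] e[OF that] by (cases "w a = 0") (auto simp: mult.commute[of B] intro!: mult_left_mono)
  have B: "((\<lambda>a. B * w a) has_sum B * s) A"
    using w(1) by (rule has_sum_cmult_right)
  have "(\<lambda>a. norm (w a *\<^sub>R e a)) summable_on A"
    using le by (intro summable_on_comparison_test[OF has_sum_imp_summable[OF B]]) auto
  then show summ: "(\<lambda>a. w a *\<^sub>R e a) summable_on A"
    by (rule abs_summable_summable)
  show "norm (\<Sum>\<^sub>\<infinity>a\<in>A. w a *\<^sub>R e a) \<le> B * s"
    by (rule norm_infsum_le[OF has_sum_infsum[OF summ] B le])
qed

text \<open>At \<open>x0\<close> a finite set \<open>A\<close> of indices carries almost the whole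
  mass 1. Its mass \<open>p\<close> is continuous, so \<open>A\<close> still carries almost
  everything near \<open>x0\<close>; the finite sum \<open>H\<close> is continuous and the tail is
  at most \<open>B * (1 - p x)\<close>. Local boundedness of the vectors with nonzero weight takes
  the place of locally finite supports.\<close>

lemma continuous_on_weighted_infsum:
  fixes e :: "'i \<Rightarrow> 'e::banach" and g :: "'i \<Rightarrow> 'x::metric_space \<Rightarrow> real"
  assumes g: "\<And>a x. 0 \<le> g a x" "\<And>a. continuous_on UNIV (g a)" "\<And>x. ((\<lambda>a. g a x) has_sum 1) UNIV"
    and loc: "\<And>x0. \<exists>r>0. \<exists>B. \<forall>x\<in>ball x0 r. \<forall>a. g a x \<noteq> 0 \<longrightarrow> norm (e a) \<le> B"
  shows "continuous_on UNIV (\<lambda>x. \<Sum>\<^sub>\<infinity>a. g a x *\<^sub>R e a)"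
proof -
  define h where "h x = (\<Sum>\<^sub>\<infinity>a. g a x *\<^sub>R e a)" for x
  have "isCont h x0" for x0
    unfolding isCont_def
  proof (rule tendstoI)
    fix \<eta> :: real assume "\<eta> > 0"
    obtain r B0 where r: "r > 0" "\<And>x a. dist x0 x < r \<Longrightarrow> g a x \<noteq> 0 \<Longrightarrow> norm (e a) \<le> B0"
      using loc[of x0] unfolding mem_ball[symmetric] by blast
    \<comment> \<open>The maximum with 1 makes \<open>B\<close> positive, which the division in
      \<open>\<theta>\<close> and the strict estimates below rely on.\<close>
    define B where "B = max 1 B0"
    have B: "1 \<le> B" "\<And>x a. dist x0 x < r \<Longrightarrow> g a x \<noteq> 0 \<Longrightarrow> norm (e a) \<le> B"
      using r(2) by (auto simp: B_def le_max_iff_disj)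
    \<comment> \<open>The tails at \<open>x0\<close> and at \<open>x\<close> will cost less than
      \<open>\<eta> / 4\<close> and \<open>\<eta> / 2\<close>, and the change of the finite sum less
      than \<open>\<eta> / 4\<close>.\<close>
    define \<theta> where "\<theta> = \<eta> / (4 * B)"
    have \<theta>: "\<theta> > 0" "B * \<theta> = \<eta> / 4" using \<open>\<eta> > 0\<close> B(1) by (auto simp: \<theta>_def)
    obtain A where A: "finite A" "dist (\<Sum>a\<in>A. g a x0) 1 < \<theta>"
      using \<theta>(1) g(3)[of x0] unfolding has_sum_def tendsto_iff eventually_finite_subsets_at_top
      by blast
    define p where "p x = (\<Sum>a\<in>A. g a x)" for x
    define H where "H x = (\<Sum>a\<in>A. g a x *\<^sub>R e a)" for x
    have tail: "norm (h x - H x) \<le> B * (1 - p x)" if "dist x0 x < r" for x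
    proof -
      have hs: "((\<lambda>a. g a x) has_sum (1 - p x)) (UNIV - A)"
        using g(3)[of x] A(1) unfolding p_def by (intro has_sum_Diff has_sum_finite) auto
      have "(\<lambda>a. g a x *\<^sub>R e a) summable_on UNIV"
        by (rule norm_weighted_infsum_le(1)[OF g(3) g(1) B(2)[OF that]])
      then have "h x - H x = (\<Sum>\<^sub>\<infinity>a\<in>UNIV - A. g a x *\<^sub>R e a)"
        unfolding h_def H_def using A(1) by (subst infsum_Diff) auto
      also have "norm \<dots> \<le> B * (1 - p x)"
        by (rule norm_weighted_infsum_le(2)[OF hs g(1) B(2)[OF that]])
      finally show ?thesis .
    qed
    have contg: "isCont (g a) x" for a x
      using g(2)[of a] by (simp add: continuous_on_eq_continuous_at)
    have "isCont p x0" "isCont H x0"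
      unfolding p_def H_def by (intro continuous_intros contg)+
    then have "\<forall>\<^sub>F x in at x0. dist (p x) (p x0) < \<theta>" "\<forall>\<^sub>F x in at x0. dist (H x) (H x0) < \<eta> / 4"
      using \<theta>(1) \<open>\<eta> > 0\<close> unfolding isCont_def by (auto intro!: tendstoD simp del: less_divide_eq_numeral1)
    moreover have "\<forall>\<^sub>F x in at x0. dist x0 x < r"
      using r(1) by (auto simp: eventually_at dist_commute intro!: exI[of _ r])
    ultimately show "\<forall>\<^sub>F x in at x0. dist (h x) (h x0) < \<eta>"
    proof eventually_elim
      case (elim x)
      have "1 - p x0 < \<theta>" using A(2) by (simp add: p_def dist_real_def)
      moreover have "1 - p x < 2 * \<theta>" using elim(1) calculation by (simp add: dist_real_def)
      ultimately have "B * (1 - p x0) < \<eta> / 4" "B * (1 - p x) < 2 * (\<eta> / 4)"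
        using B(1) unfolding \<theta>(2)[symmetric] by simp_all
      moreover have "norm (h x0 - H x0) \<le> B * (1 - p x0)" using tail[of x0] r(1) by simp
      moreover note tail[OF elim(3)]
      moreover have "norm (h x - h x0) \<le> norm (h x - H x) + norm (H x - H x0) + norm (h x0 - H x0)"
        using norm_triangle_ineq[of "h x - H x" "H x - H x0"] norm_triangle_ineq4[of "h x - H x0" "h x0 - H x0"]
        by simp
      ultimately show ?case using elim(2) by (simp add: dist_norm)
    qed
  qed
  then show ?thesis unfolding h_def by (simp add: continuous_on_eq_continuous_at)
qed

text \<open>Average arbitrary, possibly discontinuous lifts \<open>e a\<close> with weights that
  vanish unless \<open>a\<close> is within \<open>\<delta>\<close> of \<open>y\<close>. Under
  \<open>q\<close> this becomes an average of such points \<open>a\<close>, which stays within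
  \<open>\<delta>\<close> of \<open>y\<close>, and the lifts involved have norm at most
  \<open>norm y + \<delta>\<close>.\<close>

lemma approximate_continuous_selection:
  fixes q :: "'e::banach \<Rightarrow>\<^sub>L 'f::real_normed_vector"
  assumes lift: "\<And>y. \<exists>x. q x = y \<and> norm x \<le> norm y" and "\<delta> > 0"
  obtains h :: "'f \<Rightarrow> 'e" where "continuous_on UNIV h"
    "\<And>y. norm (h y) \<le> norm y + \<delta>" "\<And>y. norm (y - q (h y)) \<le> \<delta>"
proof -
  obtain g :: "'f \<Rightarrow> 'f \<Rightarrow> real" where g: "\<And>a x. 0 \<le> g a x" "\<And>a. continuous_on UNIV (g a)"
    "\<And>a x. g a x \<noteq> 0 \<Longrightarrow> dist x a < \<delta>" "\<And>x. ((\<lambda>a. g a x) has_sum 1) UNIV"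
    by (rule partition_of_unity_small_supports[OF \<open>\<delta> > 0\<close>]) blast
  obtain e where e: "\<And>a. q (e a) = a" "\<And>a. norm (e a) \<le> norm a" using lift by metis
  have e_le: "norm (e a) \<le> norm y + \<delta>" if "g a y \<noteq> 0" for a y
    using e(2)[of a] g(3)[OF that] norm_triangle_ineq2[of a y] by (simp add: dist_norm norm_minus_commute)
  define h where "h y = (\<Sum>\<^sub>\<infinity>a. g a y *\<^sub>R e a)" for y
  show ?thesis
  proof (rule that[of h])
    show "continuous_on UNIV h"
      unfolding h_def
    proof (rule continuous_on_weighted_infsum[OF g(1,2,4)])
      fix x0 :: 'f
      have "norm (e a) \<le> norm x0 + 1 + \<delta>" if "dist x0 x < 1" "g a x \<noteq> 0" for x a
        using e_le[OF that(2)] that(1) norm_triangle_ineq2[of x x0] by (simp add: dist_norm norm_minus_commute)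
      then show "\<exists>r>0. \<exists>B. \<forall>x\<in>ball x0 r. \<forall>a. g a x \<noteq> 0 \<longrightarrow> norm (e a) \<le> B"
        by (intro exI[of _ 1] conjI exI[of _ "norm x0 + 1 + \<delta>"]) auto
    qed
    fix y
    show "norm (h y) \<le> norm y + \<delta>"
      using norm_weighted_infsum_le(2)[OF g(4) g(1) e_le, of y] by (simp add: h_def)
    have summ: "(\<lambda>a. g a y *\<^sub>R e a) summable_on UNIV"
      by (rule norm_weighted_infsum_le(1)[OF g(4) g(1) e_le])
    have "((\<lambda>a. q (g a y *\<^sub>R e a)) has_sum q (h y)) UNIV"
      unfolding h_def by (rule has_sum_bounded_linear[OF blinfun.bounded_linear_right has_sum_infsum[OF summ]])
    then have "((\<lambda>a. g a y *\<^sub>R a) has_sum q (h y)) UNIV"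
      by (simp add: blinfun.scaleR_right e(1))
    then have "((\<lambda>a. - (g a y *\<^sub>R a)) has_sum - q (h y)) UNIV"
      by (simp add: has_sum_uminus)
    \<comment> \<open>As the weights sum to 1, \<open>y\<close> is the weighted sum of the constant
      \<open>y\<close>, and \<open>y - q (h y)\<close> is an average of the differences
      \<open>y - a\<close>.\<close>
    moreover have "((\<lambda>a. g a y *\<^sub>R y) has_sum 1 *\<^sub>R y) UNIV"
      using g(4) by (intro has_sum_bounded_linear[OF bounded_linear_scaleR_left])
    ultimately have diff: "((\<lambda>a. g a y *\<^sub>R y + - (g a y *\<^sub>R a)) has_sum (1 *\<^sub>R y + - q (h y))) UNIV"
      by (intro has_sum_add)
    have "((\<lambda>a. g a y * \<delta>) has_sum 1 * \<delta>) UNIV"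
      by (intro has_sum_cmult_left g(4))
    moreover have "norm (g a y *\<^sub>R y + - (g a y *\<^sub>R a)) \<le> g a y * \<delta>" for a
      using g(1)[of a y] g(3)[of a y]
      by (cases "g a y = 0") (auto simp: dist_norm mult_left_mono simp flip: scaleR_diff_right)
    ultimately have "norm (1 *\<^sub>R y + - q (h y)) \<le> 1 * \<delta>"
      by (rule norm_infsum_le[OF diff])
    then show "norm (y - q (h y)) \<le> \<delta>" by simp
  qed
qed

text \<open>Selecting approximately from the residual \<open>y - q (s n y)\<close>, whose norm is at most
  \<open>\<epsilon> / 2 ^ (n + 2)\<close>, gives a uniformly convergent series of corrections.\<close>

lemma bartle_graves:
  fixes q :: "'e::banach \<Rightarrow>\<^sub>L 'f::real_normed_vector"
  assumes lift: "\<And>y. \<exists>x. q x = y \<and> norm x \<le> norm y" and "\<epsilon> > 0"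
  obtains s :: "'f \<Rightarrow> 'e" where "continuous_on UNIV s"
    "\<And>y. q (s y) = y" "\<And>y. norm (s y) \<le> norm y + \<epsilon>"
proof -
  \<comment> \<open>The first selection costs \<open>\<delta> 0\<close> and all corrections together
    at most \<open>3 * \<delta> 0\<close>, so the factor \<open>1 / 4\<close> makes the total
    \<open>\<epsilon>\<close>.\<close>
  define \<delta> where "\<delta> n = \<epsilon> / 4 * (1 / 2) ^ n" for n :: nat
  have \<delta>: "\<delta> n > 0" for n using \<open>\<epsilon> > 0\<close> by (simp add: \<delta>_def)
  have "\<exists>h :: 'f \<Rightarrow> 'e. continuous_on UNIV h \<and> (\<forall>y. norm (h y) \<le> norm y + \<delta> n) \<and> (\<forall>y. norm (y - q (h y)) \<le> \<delta> n)" for n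
    by (rule approximate_continuous_selection[OF lift \<delta>[of n]]) blast
  then obtain h :: "nat \<Rightarrow> 'f \<Rightarrow> 'e" where h: "\<And>n. continuous_on UNIV (h n)"
    "\<And>n y. norm (h n y) \<le> norm y + \<delta> n" "\<And>n y. norm (y - q (h n y)) \<le> \<delta> n"
    by metis
  define s where "s = rec_nat (h 0) (\<lambda>n f y. f y + h (Suc n) (y - q (f y)))"
  have s0: "s 0 = h 0" and sS: "s (Suc n) = (\<lambda>y. s n y + h (Suc n) (y - q (s n y)))" for n
    by (simp_all add: s_def)
  have cont: "continuous_on UNIV (s n)" for n
  proof (induction n)
    case 0
    then show ?case by (simp add: s0 h(1))
  next
    case (Suc n)
    then show ?case
      unfolding sS by (intro continuous_intros continuous_on_compose2[OF h(1)]) auto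
  qed
  have res: "norm (y - q (s n y)) \<le> \<delta> n" for n y
  proof (cases n)
    case 0
    then show ?thesis using h(3)[of y 0] by (simp add: s0)
  next
    \<comment> \<open>The new residual is \<open>r - q (h n r)\<close> for the old residual
      \<open>r\<close>.\<close>
    case (Suc k)
    then show ?thesis
      using h(3)[of "y - q (s k y)" n] by (simp add: sS blinfun.add_right algebra_simps)
  qed
  \<comment> \<open>The correction has norm at most \<open>\<delta> n + \<delta> (Suc n)\<close>,
    which is \<open>3 / 2 * \<delta> n\<close>; written as a difference, this bound
    telescopes.\<close>
  have step: "norm (s (Suc n) y - s n y) \<le> 3 * \<delta> n - 3 * \<delta> (Suc n)" for n y
    using h(2)[of "Suc n" "y - q (s n y)"] res[of y n] by (simp add: sS \<delta>_def)
  have dist_s: "norm (s (n + k) y - s n y) \<le> 3 * \<delta> n - 3 * \<delta> (n + k)" for n k y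
  proof (induction k)
    case (Suc k)
    have "norm (s (n + Suc k) y - s n y) \<le> norm (s (n + k) y - s n y) + norm (s (Suc (n + k)) y - s (n + k) y)"
      using norm_triangle_ineq[of "s (n + k) y - s n y" "s (Suc (n + k)) y - s (n + k) y"] by simp
    then show ?case using step[of "n + k" y] Suc by simp
  qed simp
  have \<delta>0: "\<delta> \<longlonglongrightarrow> 0"
    unfolding \<delta>_def by (intro tendsto_mult_right_zero LIMSEQ_power_zero) simp
  have "uniformly_Cauchy_on UNIV s"
  proof (rule uniformly_Cauchy_onI')
    fix e :: real assume "e > 0"
    then have "\<forall>\<^sub>F n in sequentially. \<delta> n < e / 3"
      using \<delta>0 by (intro order_tendstoD) auto
    then obtain M where M: "\<And>n. n \<ge> M \<Longrightarrow> \<delta> n < e / 3"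
      by (auto simp: eventually_sequentially)
    have "dist (s m y) (s n y) < e" if "m \<ge> M" "n > m" for m n y
      using dist_s[of m "n - m" y] M[OF that(1)] that(2) \<delta>[of n]
      by (simp add: dist_norm norm_minus_commute)
    then show "\<exists>M. \<forall>y\<in>UNIV. \<forall>m\<ge>M. \<forall>n>m. dist (s m y) (s n y) < e" by blast
  qed
  then obtain l where l: "uniform_limit UNIV s l sequentially"
    using Cauchy_uniformly_convergent uniformly_convergent_on_def by blast
  have lim: "(\<lambda>n. s n y) \<longlonglongrightarrow> l y" for y
    using l by (rule tendsto_uniform_limitI) simp
  show ?thesis
  proof (rule that[of l])
    show "continuous_on UNIV l"
      using cont l by (intro uniform_limit_theorem[of _ s]) auto
    fix y
    have "(\<lambda>n. norm (y - q (s n y))) \<longlonglongrightarrow> norm (y - q (l y))"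
      by (intro tendsto_intros lim)
    then have "norm (y - q (l y)) \<le> 0"
      by (rule LIMSEQ_le[OF _ \<delta>0]) (use res in blast)
    then show "q (l y) = y" by simp
    have "norm (s n y) \<le> norm y + \<epsilon>" for n
    proof -
      have "norm (s n y - s 0 y) \<le> 3 * \<delta> 0"
        using dist_s[of 0 n y] \<delta>[of n] by simp
      moreover have "norm (s 0 y) \<le> norm y + \<delta> 0" using h(2) by (simp add: s0)
      moreover have "norm (s n y) \<le> norm (s n y - s 0 y) + norm (s 0 y)"
        by (metis diff_add_cancel norm_triangle_ineq)
      ultimately show ?thesis by (simp add: \<delta>_def)
    qed
    then show "norm (l y) \<le> norm y + \<epsilon>"
      by (intro LIMSEQ_le_const2[OF tendsto_norm[OF lim]]) auto
  qed
qed

section \<open>The Hahn--Banach theorem\<close>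

text \<open>Functionals are represented by their graphs, subspaces of \<open>'v \<times> real\<close>; the bound
  \<open>r \<le> c * norm x\<close> on the graph forces it to be single-valued.\<close>

lemma hahn_banach_graph:
  fixes G0 :: "('v::real_normed_vector \<times> real) set"
  assumes G0: "subspace G0" "\<And>x r. (x, r) \<in> G0 \<Longrightarrow> r \<le> c * norm x" and c: "0 \<le> c"
  obtains \<mu> :: "'v \<Rightarrow>\<^sub>L real" where "norm \<mu> \<le> c" "\<And>x r. (x, r) \<in> G0 \<Longrightarrow> \<mu> x = r"
proof -
  define \<A> where "\<A> = {G. subspace G \<and> G0 \<subseteq> G \<and> (\<forall>(x, r)\<in>G. r \<le> c * norm x)}"
  have "\<exists>G\<in>\<A>. \<forall>X\<in>\<A>. G \<subseteq> X \<longrightarrow> X = G"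
  proof (rule subset_Zorn_nonempty)
    show "\<A> \<noteq> {}" using G0 by (auto simp: \<A>_def)
    fix \<C> assume \<C>: "\<C> \<noteq> {}" "subset.chain \<A> \<C>"
    then have sub: "\<C> \<subseteq> \<A>" and lin: "\<And>X Y. X \<in> \<C> \<Longrightarrow> Y \<in> \<C> \<Longrightarrow> X \<subseteq> Y \<or> Y \<subseteq> X"
      by (auto simp: subset_chain_def)
    have subs: "subspace X" if "X \<in> \<C>" for X using that sub by (auto simp: \<A>_def)
    have "subspace (\<Union>\<C>)"
      unfolding subspace_def
    proof (intro conjI ballI allI)
      show "0 \<in> \<Union>\<C>" using \<C>(1) subs subspace_0 by blast
      show "x + y \<in> \<Union>\<C>" if xy: "x \<in> \<Union>\<C>" "y \<in> \<Union>\<C>" for x y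
      proof -
        obtain X Y where XY: "X \<in> \<C>" "x \<in> X" "Y \<in> \<C>" "y \<in> Y" using xy by blast
        then obtain Z where "Z \<in> \<C>" "x \<in> Z" "y \<in> Z" using lin[of X Y] by blast
        then show ?thesis using subspace_add[OF subs] by blast
      qed
      show "a *\<^sub>R x \<in> \<Union>\<C>" if "x \<in> \<Union>\<C>" for x a
        using that subspace_scale[OF subs] by blast
    qed
    with \<C>(1) sub show "\<Union>\<C> \<in> \<A>" unfolding \<A>_def by blast
  qed
  then obtain G where G: "G \<in> \<A>" and max: "\<And>X. X \<in> \<A> \<Longrightarrow> G \<subseteq> X \<Longrightarrow> X = G" by blast
  then have sub: "subspace G" and G0G: "G0 \<subseteq> G" and le: "\<And>x r. (x, r) \<in> G \<Longrightarrow> r \<le> c * norm x"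
    by (auto simp: \<A>_def)
  have total: "\<exists>t. (x0, t) \<in> G" for x0
  proof -
    \<comment> \<open>A value \<open>t\<close> at \<open>x0\<close> must satisfy
      \<open>r - t \<le> c * norm (x - x0)\<close> and \<open>s + t \<le> c * norm (y + x0)\<close>
      on the graph. \<open>L\<close> collects the lower bounds for \<open>t\<close>, and
      \<open>sep\<close> puts them below every upper bound.\<close>
    define L where "L = (\<lambda>(x, r). r - c * norm (x - x0)) ` G"
    have sep: "r - c * norm (x - x0) \<le> c * norm (y + x0) - s" if "(x, r) \<in> G" "(y, s) \<in> G" for x r y s
    proof -
      have "(x + y, r + s) \<in> G" using subspace_add[OF sub that] by simp
      then have "r + s \<le> c * norm (x + y)" by (rule le)
      also have "\<dots> \<le> c * (norm (x - x0) + norm (y + x0))"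
        using norm_triangle_ineq[of "x - x0" "y + x0"] c by (intro mult_left_mono) (simp_all add: algebra_simps)
      finally show ?thesis by (simp add: algebra_simps)
    qed
    have ne: "L \<noteq> {}" using subspace_0[OF sub] by (auto simp: L_def)
    have bdd: "bdd_above L"
      using sep[OF _ subspace_0[OF sub, unfolded zero_prod_def]]
      by (intro bdd_aboveI[of _ "c * norm x0"]) (auto simp: L_def)
    define t where "t = Sup L"
    have t1: "r - t \<le> c * norm (x - x0)" if "(x, r) \<in> G" for x r
    proof -
      have "r - c * norm (x - x0) \<in> L" using that by (force simp: L_def)
      then have "r - c * norm (x - x0) \<le> t" unfolding t_def using bdd by (rule cSup_upper)
      then show ?thesis by simp
    qed
    have t2: "s + t \<le> c * norm (y + x0)" if "(y, s) \<in> G" for y s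
    proof -
      have "t \<le> c * norm (y + x0) - s"
        unfolding t_def by (rule cSup_least[OF ne]) (use sep that in \<open>auto simp: L_def\<close>)
      then show ?thesis by simp
    qed
    define G' where "G' = {(x + a *\<^sub>R x0, r + a * t) | x r a. (x, r) \<in> G}"
    have "subspace G'"
      unfolding subspace_def
    proof (intro conjI ballI allI)
      show "0 \<in> G'"
        using subspace_0[OF sub] unfolding G'_def zero_prod_def
        by (intro CollectI exI[of _ 0]) simp
      fix p assume "p \<in> G'"
      then obtain x r a where p: "p = (x + a *\<^sub>R x0, r + a * t)" "(x, r) \<in> G"
        unfolding G'_def by blast
      show "b *\<^sub>R p \<in> G'" for b
        unfolding G'_def using p subspace_scale[OF sub p(2), of b]
        by (intro CollectI exI[of _ "b *\<^sub>R x"] exI[of _ "b * r"] exI[of _ "b * a"]) (simp add: algebra_simps)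
      fix q assume "q \<in> G'"
      then obtain y s b where q: "q = (y + b *\<^sub>R x0, s + b * t)" "(y, s) \<in> G"
        unfolding G'_def by blast
      show "p + q \<in> G'"
        unfolding G'_def using p q subspace_add[OF sub p(2) q(2)]
        by (intro CollectI exI[of _ "x + y"] exI[of _ "r + s"] exI[of _ "a + b"]) (simp add: algebra_simps)
    qed
    moreover have GG': "G \<subseteq> G'"
    proof clarify
      fix x r assume "(x, r) \<in> G"
      then show "(x, r) \<in> G'"
        unfolding G'_def by (intro CollectI exI[of _ x] exI[of _ r] exI[of _ 0]) simp
    qed
    \<comment> \<open>For \<open>a = 0\<close> this is the bound on \<open>G\<close>; otherwise
      division by \<open>\<bar>a\<bar>\<close> reduces it to \<open>t2\<close> or \<open>t1\<close>,
      according to the sign of \<open>a\<close>.\<close>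
    moreover have "r + a * t \<le> c * norm (x + a *\<^sub>R x0)" if xr: "(x, r) \<in> G" for x r a
    proof -
      consider "a = 0" | "a > 0" | "a < 0" by linarith
      then show ?thesis
      proof cases
        case 1
        then show ?thesis using le[OF xr] by simp
      next
        case 2
        have "(x /\<^sub>R a, r / a) \<in> G" using subspace_scale[OF sub xr, of "inverse a"] by (simp add: divide_inverse_commute)
        then have "a * (r / a + t) \<le> a * (c * norm (x /\<^sub>R a + x0))"
          using t2 2 by (intro mult_left_mono) auto
        also have "\<dots> = c * norm (a *\<^sub>R (x /\<^sub>R a + x0))"
          using 2 by simp
        finally show ?thesis using 2 by (simp add: algebra_simps)
      next
        case 3
        have "(x /\<^sub>R (-a), r / (-a)) \<in> G" using subspace_scale[OF sub xr, of "inverse (-a)"] by (simp add: divide_inverse_commute)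
        then have "(-a) * (r / (-a) - t) \<le> (-a) * (c * norm (x /\<^sub>R (-a) - x0))"
          using t1 3 by (intro mult_left_mono) auto
        also have "\<dots> = c * norm ((-a) *\<^sub>R (x /\<^sub>R (-a) - x0))"
          using 3 by simp
        finally show ?thesis using 3 by (simp add: algebra_simps)
      qed
    qed
    ultimately have "G' \<in> \<A>" using G0G unfolding \<A>_def by (auto simp: G'_def)
    then have "G' = G" using GG' by (rule max)
    moreover have "(x0, t) \<in> G'"
      using subspace_0[OF sub] unfolding G'_def zero_prod_def
      by (intro CollectI exI[of _ 0] exI[of _ 1]) simp
    ultimately show ?thesis by blast
  qed
  \<comment> \<open>The two pairs differ by \<open>(0, r - s)\<close>, and the bound at 0 is
    0.\<close>
  have uniq: "r = s" if "(x, r) \<in> G" "(x, s) \<in> G" for x r s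
    using le[of 0 "r - s"] le[of 0 "s - r"] subspace_diff[OF sub that] subspace_diff[OF sub that(2,1)]
    by simp
  obtain \<phi> where \<phi>: "\<And>x. (x, \<phi> x) \<in> G" using total by metis
  have lin: "\<phi> (x + y) = \<phi> x + \<phi> y" "\<phi> (a *\<^sub>R x) = a * \<phi> x" for x y a
    using uniq[OF \<phi>, of "x + y" "\<phi> x + \<phi> y"] subspace_add[OF sub \<phi> \<phi>, of x y]
      uniq[OF \<phi>, of "a *\<^sub>R x" "a * \<phi> x"] subspace_scale[OF sub \<phi>, of a x] by simp_all
  have bound: "\<bar>\<phi> x\<bar> \<le> c * norm x" for x
    using le[OF \<phi>, of x] le[OF \<phi>, of "- x"] lin(2)[of "-1" x] by simp
  have bl: "bounded_linear \<phi>"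
    by (rule bounded_linear_intro[of _ c]) (use lin bound in \<open>auto simp: mult.commute\<close>)
  show ?thesis
  proof (rule that[of "Blinfun \<phi>"])
    show "norm (Blinfun \<phi>) \<le> c"
      using c bound by (intro norm_blinfun_bound) (auto simp: bounded_linear_Blinfun_apply[OF bl])
    show "Blinfun \<phi> x = r" if "(x, r) \<in> G0" for x r
      using uniq[OF \<phi>] that G0G by (auto simp: bounded_linear_Blinfun_apply[OF bl])
  qed
qed

text \<open>As \<open>J\<close> is isometric,
  \<open>\<phi> x \<le> norm \<phi> * norm (J x)\<close>, so the pairs
  \<open>(J x, \<phi> x)\<close> form a graph that can be extended. The adjoint of \<open>J\<close>
  is thus onto, with lifts of no larger norm, as \<open>bartle_graves\<close> asks.\<close>

lemma hahn_banach_lift: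
  fixes J :: "'v::real_normed_vector \<Rightarrow>\<^sub>L 'w::real_normed_vector" and \<phi> :: "'v \<Rightarrow>\<^sub>L real"
  assumes iso: "\<And>x. norm (J x) = norm x"
  obtains \<mu> :: "'w \<Rightarrow>\<^sub>L real" where "norm \<mu> \<le> norm \<phi>" "\<mu> o\<^sub>L J = \<phi>"
proof -
  let ?G0 = "range (\<lambda>x. (J x, \<phi> x))"
  have "linear (\<lambda>x. (J x, \<phi> x))"
    by (rule linearI) (simp_all add: blinfun.bilinear_simps)
  then have "subspace ?G0" by (rule linear_subspace_image[OF _ subspace_UNIV])
  moreover have "r \<le> norm \<phi> * norm y" if "(y, r) \<in> ?G0" for y r
    using that norm_blinfun[of \<phi>] iso by (auto intro: order_trans[OF abs_ge_self])
  ultimately show ?thesis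
  proof (rule hahn_banach_graph[OF _ _ norm_ge_zero])
    fix \<mu> :: "'w \<Rightarrow>\<^sub>L real"
    assume "norm \<mu> \<le> norm \<phi>" "\<And>y r. (y, r) \<in> ?G0 \<Longrightarrow> \<mu> y = r"
    then show thesis by (intro that[of \<mu>] blinfun_eqI) auto
  qed
qed

section \<open>Continuous functions on the compactification\<close>

lemma cbeta_dist_le: "\<bar>apply_cbeta F \<xi> - apply_cbeta G \<xi>\<bar> \<le> dist F G"
  using cbeta_le_norm[of "F - G" \<xi>] by (simp add: dist_norm)

text \<open>The pointwise limit of a Cauchy sequence is a uniform limit, hence continuous.
  Completeness lets finite nets prove compactness of operators into \<open>cbeta\<close>.\<close>

instance cbeta :: (metric_space) banach
proof
  fix X :: "nat \<Rightarrow> 'a cbeta" assume X: "Cauchy X"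
  let ?K = "stone_cech (offdiag :: ('a \<times> 'a) topology)"
  have "Cauchy (\<lambda>n. X n \<xi>)" for \<xi>
  proof (rule metric_CauchyI)
    fix e :: real assume "e > 0"
    then obtain M where "\<forall>m\<ge>M. \<forall>n\<ge>M. dist (X m) (X n) < e"
      using metric_CauchyD[OF X] by blast
    then show "\<exists>M. \<forall>m\<ge>M. \<forall>n\<ge>M. dist (X m \<xi>) (X n \<xi>) < e"
      using cbeta_dist_le by (metis dist_real_def order_le_less_trans)
  qed
  then obtain l where l: "\<And>\<xi>. (\<lambda>n. X n \<xi>) \<longlonglongrightarrow> l \<xi>"
    unfolding Cauchy_convergent_iff convergent_def by metis
  have unif: "\<exists>M. \<forall>n\<ge>M. \<forall>\<xi>. \<bar>X n \<xi> - l \<xi>\<bar> \<le> e" if e: "e > 0" for e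
  proof -
    obtain M where M: "\<forall>m\<ge>M. \<forall>n\<ge>M. dist (X m) (X n) < e"
      using metric_CauchyD[OF X e] by blast
    have "\<bar>X n \<xi> - l \<xi>\<bar> \<le> e" if "n \<ge> M" for n \<xi>
    proof (rule LIMSEQ_le_const2)
      show "(\<lambda>m. \<bar>X n \<xi> - X m \<xi>\<bar>) \<longlonglongrightarrow> \<bar>X n \<xi> - l \<xi>\<bar>"
        by (intro tendsto_intros l)
      show "\<exists>N. \<forall>m\<ge>N. \<bar>X n \<xi> - X m \<xi>\<bar> \<le> e"
        using M that cbeta_dist_le by (meson less_imp_le order_trans)
    qed
    then show ?thesis by blast
  qed
  have "continuous_map ?K Met_TC.mtopology l"
  proof (rule Met_TC.continuous_map_uniform_limit)
    show "\<forall>\<^sub>F n in sequentially. continuous_map ?K Met_TC.mtopology (apply_cbeta (X n))"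
      by (simp add: apply_cbeta_continuous)
    fix e :: real assume "e > 0"
    then obtain M where M: "\<forall>n\<ge>M. \<forall>\<xi>. \<bar>X n \<xi> - l \<xi>\<bar> \<le> e / 2"
      using unif[of "e / 2"] by auto
    have "dist (X n \<xi>) (l \<xi>) < e" if "n \<ge> M" for n \<xi>
      using M that \<open>e > 0\<close> by (smt (verit) dist_real_def field_sum_of_halves)
    then show "\<forall>\<^sub>F n in sequentially. \<forall>\<xi>\<in>topspace ?K. l \<xi> \<in> UNIV \<and> dist (X n \<xi>) (l \<xi>) < e"
      unfolding eventually_sequentially by blast
  qed simp
  moreover have "l \<xi> = 0" if "\<xi> \<notin> topspace ?K" for \<xi>
    using l[of \<xi>] that by (simp add: apply_cbeta_outside LIMSEQ_const_iff)
  ultimately have L: "apply_cbeta (Abs_cbeta l) = l"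
    by (intro Abs_cbeta_inverse) simp
  have "X \<longlonglongrightarrow> Abs_cbeta l"
  proof (rule metric_LIMSEQ_I)
    fix e :: real assume "e > 0"
    then obtain M where M: "\<forall>n\<ge>M. \<forall>\<xi>. \<bar>X n \<xi> - l \<xi>\<bar> \<le> e / 2"
      using unif[of "e / 2"] by auto
    have "dist (X n) (Abs_cbeta l) < e" if "n \<ge> M" for n
    proof -
      have "norm (X n - Abs_cbeta l) \<le> e / 2"
        using M that \<open>e > 0\<close> by (intro norm_cbeta_le) (auto simp: L)
      then show ?thesis using \<open>e > 0\<close> by (simp add: dist_norm)
    qed
    then show "\<exists>M. \<forall>n\<ge>M. dist (X n) (Abs_cbeta l) < e" by blast
  qed
  then show "convergent X" by (rule convergentI)
qed

text \<open>The points where \<open>F\<close> lies in \<open>{- C..C}\<close> form a closed set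
  containing the dense image of the off-diagonal pairs.\<close>

lemma norm_cbeta_le_dense:
  fixes F :: "'a::metric_space cbeta"
  assumes "0 \<le> C" "\<And>x y. x \<noteq> y \<Longrightarrow> \<bar>F (stone_cech_embed offdiag (x, y))\<bar> \<le> C"
  shows "norm F \<le> C"
proof (rule norm_cbeta_le[OF assms(1)])
  fix \<xi> :: "('a \<times> 'a \<Rightarrow> real) \<Rightarrow> real"
  assume "\<xi> \<in> topspace (stone_cech offdiag)"
  then have \<xi>: "\<xi> \<in> stone_cech offdiag closure_of (stone_cech_embed offdiag ` topspace offdiag)"
    unfolding stone_cech_embed_dense .
  have "F \<xi> \<in> {- C..C}"
  proof (rule forall_in_closure_of[OF \<xi>, where P = "\<lambda>\<xi>. F \<xi> \<in> {- C..C}"])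
    show "closedin (stone_cech offdiag) {\<xi> \<in> topspace (stone_cech offdiag). F \<xi> \<in> {- C..C}}"
      by (rule closedin_continuous_map_preimage[OF apply_cbeta_continuous]) simp
    fix \<eta> :: "('a \<times> 'a \<Rightarrow> real) \<Rightarrow> real"
    assume "\<eta> \<in> stone_cech_embed offdiag ` topspace offdiag"
    then obtain x y where "\<eta> = stone_cech_embed offdiag (x, y)" "x \<noteq> y" by auto
    with assms(2)[of x y] show "F \<eta> \<in> {- C..C}" by (simp add: abs_le_iff minus_le_iff)
  qed
  then show "\<bar>F \<xi>\<bar> \<le> C" by (auto simp: abs_le_iff)
qed

text \<open>Points of the compactification are families of reals indexed by the bounded continuous
  functions, so for such \<open>h\<close> reading off the coordinate \<open>h\<close> extends
  \<open>h\<close> continuously. The value 0 elsewhere is the convention of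
  \<open>cbeta\<close>.\<close>

definition stone_cech_extend :: "('a::metric_space \<times> 'a \<Rightarrow> real) \<Rightarrow> 'a cbeta" where
  "stone_cech_extend h = Abs_cbeta (\<lambda>\<xi>. if \<xi> \<in> topspace (stone_cech offdiag) then \<xi> h else 0)"

lemma stone_cech_extend_embed:
  assumes "h \<in> bounded_continuous_maps offdiag" "x \<noteq> y"
  shows "stone_cech_extend h (stone_cech_embed offdiag (x, y)) = h (x, y)"
proof -
  let ?K = "topspace (stone_cech (offdiag :: ('a \<times> 'a) topology))"
  have "continuous_map (stone_cech offdiag) euclideanreal (\<lambda>\<xi>. if \<xi> \<in> ?K then \<xi> h else 0)"
    by (rule continuous_map_eq[OF continuous_map_stone_cech_eval[OF assms(1)]]) simp
  then have "apply_cbeta (stone_cech_extend h) = (\<lambda>\<xi>. if \<xi> \<in> ?K then \<xi> h else 0)"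
    unfolding stone_cech_extend_def by (intro Abs_cbeta_inverse) simp
  then show ?thesis
    using assms stone_cech_embed_in[of "(x, y)" offdiag] by (simp add: stone_cech_embed_def)
qed

section \<open>The de Leeuw map as a linear isometry\<close>

lemma norm_de_leeuw: "norm (de_leeuw f) = norm f"
proof (rule antisym)
  show "norm (de_leeuw f) \<le> norm f"
    by (rule norm_cbeta_le_dense)
      (simp_all add: de_leeuw_embed abs_divide divide_le_eq lip0_le_norm)
  show "norm f \<le> norm (de_leeuw f)"
  proof (rule norm_lip0_le)
    fix x y
    show "\<bar>f x - f y\<bar> \<le> norm (de_leeuw f) * dist x y"
    proof (cases "x = y")
      case False
      have "\<bar>(f x - f y) / dist x y\<bar> \<le> norm (de_leeuw f)"
        using cbeta_le_norm[of "de_leeuw f"] by (simp flip: de_leeuw_embed[OF False])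
      then show ?thesis using False by (simp add: abs_divide divide_le_eq)
    qed simp
  qed simp
qed

lemma bounded_linear_de_leeuw: "bounded_linear de_leeuw"
proof (rule bounded_linear_intro[of _ 1])
  show "de_leeuw (f + g) = de_leeuw f + de_leeuw g" for f g :: "'a lip0"
    by (rule cbeta_eqI_dense) (simp add: de_leeuw_embed add_divide_distrib diff_divide_distrib)
  show "de_leeuw (r *\<^sub>R f) = r *\<^sub>R de_leeuw f" for r and f :: "'a lip0"
    by (rule cbeta_eqI_dense) (simp add: de_leeuw_embed right_diff_distrib flip: diff_divide_distrib)
qed (simp add: norm_de_leeuw)

section \<open>Point evaluations and molecules in the dual of the Lipschitz space\<close>

definition lip0_eval :: "'a::pointed_metric_space \<Rightarrow> 'a lip0 \<Rightarrow>\<^sub>L real" where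
  "lip0_eval x = Blinfun (\<lambda>f. apply_lip0 f x)"

lemma lip0_eval_apply [simp]: "lip0_eval x f = f x"
proof -
  have "bounded_linear (\<lambda>f :: 'a lip0. apply_lip0 f x)"
    by (rule bounded_linear_intro[of _ "dist x basepoint"])
      (use lip0_le_norm[of _ x basepoint] in auto)
  then show ?thesis by (simp add: lip0_eval_def bounded_linear_Blinfun_apply)
qed

lemma continuous_on_lip0_eval: "continuous_on UNIV lip0_eval"
proof (rule lipschitz_on_continuous_on, rule lipschitz_onI)
  fix x y :: 'a
  show "dist (lip0_eval x) (lip0_eval y) \<le> 1 * dist x y"
    unfolding dist_norm[of "lip0_eval x"] using lip0_le_norm[of _ x y]
    by (intro norm_blinfun_bound) (simp_all add: blinfun.diff_left mult.commute)
qed simp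

text \<open>Forming the quotient in the dual lets norm continuity off the diagonal follow from that
  of \<open>lip0_eval\<close>. On the diagonal the molecule is 0, so \<open>norm_molecule_le\<close>
  holds for every pair.\<close>

definition molecule :: "'a::pointed_metric_space \<times> 'a \<Rightarrow> 'a lip0 \<Rightarrow>\<^sub>L real" where
  "molecule p = (lip0_eval (fst p) - lip0_eval (snd p)) /\<^sub>R dist (fst p) (snd p)"

lemma molecule_apply: "molecule (x, y) f = (f x - f y) / dist x y"
  by (simp add: molecule_def blinfun.bilinear_simps divide_inverse_commute)

lemma norm_molecule_le: "norm (molecule p) \<le> 1"
proof (cases p)
  case (Pair x y)
  have "\<bar>f x - f y\<bar> / dist x y \<le> norm f" for f :: "'a lip0"
    using lip0_le_norm[of f x y] by (cases "x = y") (simp_all add: divide_le_eq)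
  then show ?thesis
    unfolding Pair by (intro norm_blinfun_bound) (simp_all add: molecule_apply abs_divide)
qed

lemma continuous_on_molecule: "continuous_on {(x, y). x \<noteq> y} molecule"
  unfolding molecule_def
  by (intro continuous_on_scaleR continuous_on_diff continuous_on_inverse continuous_on_dist
      continuous_on_compose2[OF continuous_on_lip0_eval] continuous_on_fst continuous_on_snd
      continuous_on_id subset_UNIV) auto

section \<open>Compactness and the extension theorem\<close>

text \<open>The idea of Schauder's theorem: up to \<open>\<eta>\<close>, the function \<open>b x\<close> is determined by its rounded
  values on a finite net of \<open>Y\<close>, and these take finitely many values.\<close>

lemma totally_bounded_transpose:
  fixes b :: "'x \<Rightarrow> 'y \<Rightarrow> real"
  assumes bdd: "\<And>x y. x \<in> X \<Longrightarrow> y \<in> Y \<Longrightarrow> \<bar>b x y\<bar> \<le> B"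
    and tb: "\<And>\<eta>. \<eta> > 0 \<Longrightarrow> \<exists>Y0. finite Y0 \<and> Y0 \<subseteq> Y \<and> (\<forall>y\<in>Y. \<exists>y0\<in>Y0. \<forall>x\<in>X. \<bar>b x y - b x y0\<bar> \<le> \<eta>)"
    and "\<eta> > 0"
  shows "\<exists>X0. finite X0 \<and> X0 \<subseteq> X \<and> (\<forall>x\<in>X. \<exists>x0\<in>X0. \<forall>y\<in>Y. \<bar>b x y - b x0 y\<bar> \<le> \<eta>)"
proof -
  \<comment> \<open>Two errors come from replacing \<open>y\<close> by \<open>y0\<close> and one
    from rounding.\<close>
  define \<theta> where "\<theta> = \<eta> / 3"
  have \<theta>: "\<theta> > 0" using \<open>\<eta> > 0\<close> by (simp add: \<theta>_def)
  obtain Y0 where Y0: "finite Y0" "Y0 \<subseteq> Y" "\<And>y. y \<in> Y \<Longrightarrow> \<exists>y0\<in>Y0. \<forall>x\<in>X. \<bar>b x y - b x y0\<bar> \<le> \<theta>"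
    using tb[OF \<theta>] by blast
  define c where "c x = (\<lambda>y\<in>Y0. \<lfloor>b x y / \<theta>\<rfloor>)" for x
  have "c ` X \<subseteq> (\<Pi>\<^sub>E y\<in>Y0. {\<lfloor>- B / \<theta>\<rfloor>..\<lfloor>B / \<theta>\<rfloor>})"
  proof (rule image_subsetI, unfold c_def, rule restrict_PiE_iff[THEN iffD2], rule ballI)
    fix x y assume "x \<in> X" "y \<in> Y0"
    then have "- B \<le> b x y" "b x y \<le> B" using bdd[of x y] Y0(2) by auto
    then have "- B / \<theta> \<le> b x y / \<theta>" "b x y / \<theta> \<le> B / \<theta>"
      using \<theta> by (intro divide_right_mono; simp)+
    then show "\<lfloor>b x y / \<theta>\<rfloor> \<in> {\<lfloor>- B / \<theta>\<rfloor>..\<lfloor>B / \<theta>\<rfloor>}"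
      by (simp only: atLeastAtMost_iff floor_mono simp_thms)
  qed
  then have fin: "finite (c ` X)"
    by (rule finite_subset) (intro finite_PiE Y0(1) finite_atLeastAtMost_int)
  \<comment> \<open>One representative for each pattern of rounded values.\<close>
  define X0 where "X0 = inv_into X c ` c ` X"
  have "\<exists>x0\<in>X0. \<forall>y\<in>Y. \<bar>b x y - b x0 y\<bar> \<le> \<eta>" if x: "x \<in> X" for x
  proof
    define x0 where "x0 = inv_into X c (c x)"
    show "x0 \<in> X0" using x by (simp add: X0_def x0_def)
    have x0: "x0 \<in> X" "c x0 = c x"
      unfolding x0_def using x by (auto intro: inv_into_into f_inv_into_f)
    show "\<forall>y\<in>Y. \<bar>b x y - b x0 y\<bar> \<le> \<eta>"
    proof
      fix y assume "y \<in> Y"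
      then obtain y0 where y0: "y0 \<in> Y0" "\<forall>x\<in>X. \<bar>b x y - b x y0\<bar> \<le> \<theta>" using Y0(3) by blast
      have "\<lfloor>b x y0 / \<theta>\<rfloor> = \<lfloor>b x0 y0 / \<theta>\<rfloor>"
        using fun_cong[OF x0(2), of y0] y0(1) by (simp add: c_def)
      then have "\<bar>b x y0 / \<theta> - b x0 y0 / \<theta>\<bar> \<le> 1" by linarith
      then have "\<bar>b x y0 - b x0 y0\<bar> \<le> \<theta>"
        using \<theta> by (simp add: abs_divide flip: diff_divide_distrib)
      moreover have "\<bar>b x y - b x y0\<bar> \<le> \<theta>" "\<bar>b x0 y - b x0 y0\<bar> \<le> \<theta>" using y0(2) x x0(1) by auto
      ultimately show "\<bar>b x y - b x0 y\<bar> \<le> \<eta>" unfolding \<theta>_def by linarith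
    qed
  qed
  moreover have "X0 \<subseteq> X" by (auto simp: X0_def intro: inv_into_into)
  ultimately show ?thesis using fin unfolding X0_def by blast
qed

section \<open>Finite nets and relative compactness of images\<close>

lemma compact_closure_image_finite_net:
  fixes f :: "'i \<Rightarrow> 'a::metric_space"
  assumes "compact (closure (f ` X))" "\<eta> > 0"
  obtains X0 where "finite X0" "X0 \<subseteq> X" "\<And>x. x \<in> X \<Longrightarrow> \<exists>x0\<in>X0. dist (f x) (f x0) \<le> \<eta>"
proof -
  \<comment> \<open>Points of the closure lie within \<open>\<eta>\<close> of the image, so balls
    centred in the image suffice and the net can be indexed by \<open>X\<close>.\<close>
  have "closure (f ` X) \<subseteq> (\<Union>x\<in>X. ball (f x) \<eta>)"
    using \<open>\<eta> > 0\<close> by (fastforce simp: closure_approachable)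
  then obtain X0 where X0: "X0 \<subseteq> X" "finite X0" "closure (f ` X) \<subseteq> (\<Union>x\<in>X0. ball (f x) \<eta>)"
    using compactE_image[OF assms(1), of X "\<lambda>x. ball (f x) \<eta>"] by (metis open_ball)
  show ?thesis
  proof (rule that[OF X0(2,1)])
    fix x assume "x \<in> X"
    then have "f x \<in> closure (f ` X)" using closure_subset[of "f ` X"] by auto
    then have "f x \<in> (\<Union>x\<in>X0. ball (f x) \<eta>)" using X0(3) by (rule set_mp[rotated])
    then show "\<exists>x0\<in>X0. dist (f x) (f x0) \<le> \<eta>" by (auto simp: dist_commute intro: less_imp_le)
  qed
qed

lemma finite_net_imp_compact_closure_image:
  fixes f :: "'i \<Rightarrow> 'a::complete_space"
  assumes "\<And>\<eta>. \<eta> > 0 \<Longrightarrow> \<exists>X0. finite X0 \<and> X0 \<subseteq> X \<and> (\<forall>x\<in>X. \<exists>x0\<in>X0. dist (f x) (f x0) \<le> \<eta>)"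
  shows "compact (closure (f ` X))"
  unfolding compact_eq_totally_bounded
proof (intro conjI allI impI)
  show "complete (closure (f ` X))" by (simp add: complete_eq_closed)
  fix \<eta> :: real assume "\<eta> > 0"
  then obtain X0 where X0: "finite X0" "\<forall>x\<in>X. \<exists>x0\<in>X0. dist (f x) (f x0) \<le> \<eta> / 2"
    using assms[of "\<eta> / 2"] by auto
  \<comment> \<open>Closed balls of half the radius have a closed finite union, which therefore
    covers the closure too.\<close>
  have "f ` X \<subseteq> (\<Union>a\<in>f ` X0. cball a (\<eta> / 2))"
    using X0(2) by (fastforce simp: dist_commute)
  then have "closure (f ` X) \<subseteq> (\<Union>a\<in>f ` X0. cball a (\<eta> / 2))"
    by (rule closure_minimal) (use X0(1) in auto)
  also have "\<dots> \<subseteq> (\<Union>a\<in>f ` X0. ball a \<eta>)"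
    using \<open>\<eta> > 0\<close> by (intro UN_mono) (auto simp: subset_eq)
  finally show "\<exists>k. finite k \<and> closure (f ` X) \<subseteq> (\<Union>x\<in>k. ball x \<eta>)"
    using X0(1) by (intro exI[of _ "f ` X0"]) simp
qed

text \<open>Molecules have norm at most 1, so a finite net for the image of the unit ball under
  \<open>S\<close> approximates \<open>f \<mapsto> molecule p (S f)\<close> uniformly in
  \<open>p\<close>. Transposing yields a finite net of functionals.\<close>

lemma compact_closure_molecules:
  fixes S :: "'a::pointed_metric_space lip0 \<Rightarrow>\<^sub>L 'b::pointed_metric_space lip0"
  assumes "compact_operator (blinfun_apply S)"
  shows "compact (closure ((\<lambda>p. molecule p o\<^sub>L S) ` P))"
proof (rule finite_net_imp_compact_closure_image)
  fix \<eta> :: real assume \<eta>: "\<eta> > 0"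
  define b where "b p f = molecule p (S f)" for p and f :: "'a lip0"
  have "\<exists>P0. finite P0 \<and> P0 \<subseteq> P \<and> (\<forall>p\<in>P. \<exists>p0\<in>P0. \<forall>f\<in>cball 0 1. \<bar>b p f - b p0 f\<bar> \<le> \<eta>)"
  proof (rule totally_bounded_transpose[OF _ _ \<eta>])
    show "\<bar>b p f\<bar> \<le> norm S" if "f \<in> cball 0 1" for p f
    proof -
      have "\<bar>b p f\<bar> \<le> norm (molecule p) * norm (S f)"
        unfolding b_def using norm_blinfun[of "molecule p" "S f"] by simp
      also have "\<dots> \<le> 1 * (norm S * norm f)"
        by (intro mult_mono norm_molecule_le norm_blinfun) auto
      also have "\<dots> \<le> norm S" using that by (simp add: mult_left_le)
      finally show ?thesis .
    qed
    fix \<theta> :: real assume \<theta>: "\<theta> > 0"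
    have "compact (closure (S ` cball 0 1))"
      using assms unfolding compact_operator_def by simp
    then obtain Y0 where Y0: "finite Y0" "Y0 \<subseteq> cball 0 1"
      "\<And>f. f \<in> cball 0 1 \<Longrightarrow> \<exists>f0\<in>Y0. dist (S f) (S f0) \<le> \<theta>"
      by (rule compact_closure_image_finite_net[OF _ \<theta>]) blast
    have "\<bar>b p f - b p f0\<bar> \<le> \<theta>" if "dist (S f) (S f0) \<le> \<theta>" for p f f0
    proof -
      have "\<bar>b p f - b p f0\<bar> \<le> norm (molecule p) * norm (S f - S f0)"
        using norm_blinfun[of "molecule p" "S f - S f0"] by (simp add: b_def blinfun.diff_right)
      also have "\<dots> \<le> 1 * norm (S f - S f0)"
        by (intro mult_right_mono norm_molecule_le) simp
      finally show ?thesis using that by (simp add: dist_norm)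
    qed
    then have "\<forall>f\<in>cball 0 1. \<exists>f0\<in>Y0. \<forall>p\<in>P. \<bar>b p f - b p f0\<bar> \<le> \<theta>"
    proof (intro ballI, goal_cases)
      case (1 f)
      show ?case using Y0(3)[OF 1(2)] 1(1) by blast
    qed
    with Y0(1,2) show "\<exists>Y0. finite Y0 \<and> Y0 \<subseteq> cball 0 1 \<and>
        (\<forall>f\<in>cball 0 1. \<exists>f0\<in>Y0. \<forall>p\<in>P. \<bar>b p f - b p f0\<bar> \<le> \<theta>)"
      by (intro exI[of _ Y0] conjI)
  qed
  then obtain P0 where P0: "finite P0" "P0 \<subseteq> P"
    "\<And>p. p \<in> P \<Longrightarrow> \<exists>p0\<in>P0. \<forall>f\<in>cball 0 1. \<bar>b p f - b p0 f\<bar> \<le> \<eta>" by blast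
  have "dist (molecule p o\<^sub>L S) (molecule p0 o\<^sub>L S) \<le> \<eta>"
    if le: "\<forall>f\<in>cball 0 1. \<bar>b p f - b p0 f\<bar> \<le> \<eta>" for p p0
    unfolding dist_norm
  proof (rule norm_blinfun_bound)
    fix f
    show "norm (blinfun_apply ((molecule p o\<^sub>L S) - (molecule p0 o\<^sub>L S)) f) \<le> \<eta> * norm f"
    proof (cases "f = 0")
      case False
      then have "\<bar>b p (f /\<^sub>R norm f) - b p0 (f /\<^sub>R norm f)\<bar> \<le> \<eta>" using le by simp
      moreover have "b p (f /\<^sub>R norm f) - b p0 (f /\<^sub>R norm f) = (b p f - b p0 f) / norm f" for p
        by (simp add: b_def blinfun.scaleR_right divide_inverse_commute algebra_simps)
      ultimately show ?thesis
        using False by (simp add: b_def blinfun.diff_left abs_divide divide_le_eq)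
    qed (simp add: blinfun.zero_right)
  qed (use \<eta> in simp)
  then have "\<forall>p\<in>P. \<exists>p0\<in>P0. dist (molecule p o\<^sub>L S) (molecule p0 o\<^sub>L S) \<le> \<eta>"
  proof (intro ballI, goal_cases)
    case (1 p)
    show ?case using P0(3)[OF 1(2)] 1(1) by blast
  qed
  with P0(1,2) show "\<exists>P0. finite P0 \<and> P0 \<subseteq> P \<and>
      (\<forall>p\<in>P. \<exists>p0\<in>P0. dist (molecule p o\<^sub>L S) (molecule p0 o\<^sub>L S) \<le> \<eta>)"
    by (intro exI[of _ P0] conjI)
qed

text \<open>For fixed \<open>v\<close> the function \<open>p \<mapsto> \<psi> p v\<close> is bounded
  and continuous, and \<open>T v\<close> is its extension. Linearity and the norm bound are checked
  on the dense set of pairs.\<close>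

lemma operator_of_functionals:
  fixes \<psi> :: "'b::metric_space \<times> 'b \<Rightarrow> 'v::real_normed_vector \<Rightarrow>\<^sub>L real"
  assumes cont: "continuous_on {(x, y). x \<noteq> y} \<psi>"
    and le: "\<And>x y. x \<noteq> y \<Longrightarrow> norm (\<psi> (x, y)) \<le> c" and "0 \<le> c"
  obtains T :: "'v \<Rightarrow>\<^sub>L 'b cbeta" where "norm T \<le> c"
    "\<And>v x y. x \<noteq> y \<Longrightarrow> T v (stone_cech_embed offdiag (x, y)) = \<psi> (x, y) v"
proof -
  define F where "F v = stone_cech_extend (\<lambda>p. \<psi> p v)" for v
  have bound: "\<bar>\<psi> (x, y) v\<bar> \<le> c * norm v" if "x \<noteq> y" for x y v
    using norm_blinfun[of "\<psi> (x, y)" v] mult_right_mono[OF le[OF that] norm_ge_zero[of v]] by simp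
  have "(\<lambda>p. \<psi> p v) \<in> bounded_continuous_maps offdiag" for v
    unfolding bounded_continuous_maps_def
  proof (intro CollectI conjI)
    show "continuous_map offdiag euclideanreal (\<lambda>p. \<psi> p v)"
      unfolding offdiag_def using blinfun.continuous_on[OF cont continuous_on_const] by simp
    show "bounded ((\<lambda>p. \<psi> p v) ` topspace offdiag)"
      using bound by (auto intro!: boundedI[of _ "c * norm v"])
  qed
  then have F: "F v (stone_cech_embed offdiag (x, y)) = \<psi> (x, y) v" if "x \<noteq> y" for v x y
    unfolding F_def using that by (simp add: stone_cech_extend_embed)
  have F_le: "norm (F v) \<le> c * norm v" for v
    using bound \<open>0 \<le> c\<close> by (intro norm_cbeta_le_dense) (auto simp: F)
  have bl: "bounded_linear F"
  proof (rule bounded_linear_intro[of _ c])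
    show "F (v + w) = F v + F w" for v w
      by (rule cbeta_eqI_dense) (simp add: F blinfun.add_right)
    show "F (r *\<^sub>R v) = r *\<^sub>R F v" for r v
      by (rule cbeta_eqI_dense) (simp add: F blinfun.scaleR_right)
    show "norm (F v) \<le> norm v * c" for v using F_le by (simp add: mult.commute)
  qed
  show ?thesis
  proof (rule that[of "Blinfun F"])
    show "norm (Blinfun F) \<le> c"
      using \<open>0 \<le> c\<close> F_le by (intro norm_blinfun_bound) (simp_all add: bounded_linear_Blinfun_apply[OF bl])
  qed (simp add: bounded_linear_Blinfun_apply[OF bl] F)
qed

text \<open>The transposition in the opposite direction: a finite net of the functionals
  \<open>\<psi> p\<close> yields, on a bounded set, a finite net of vectors, uniformly in
  \<open>p\<close>.\<close>

lemma compact_operator_of_functionals: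
  fixes \<psi> :: "'b::metric_space \<times> 'b \<Rightarrow> 'v::real_normed_vector \<Rightarrow>\<^sub>L real" and T :: "'v \<Rightarrow>\<^sub>L 'b cbeta"
  assumes T: "\<And>v x y. x \<noteq> y \<Longrightarrow> T v (stone_cech_embed offdiag (x, y)) = \<psi> (x, y) v"
    and comp: "compact (closure (\<psi> ` {(x, y). x \<noteq> y}))"
  shows "compact_operator (blinfun_apply T)"
  unfolding compact_operator_def
proof (intro conjI allI impI)
  show "bounded_linear (blinfun_apply T)" by (rule blinfun.bounded_linear_right)
  fix V :: "'v set" assume "bounded V"
  then obtain R where R: "R > 0" "\<And>v. v \<in> V \<Longrightarrow> norm v \<le> R" by (auto simp: bounded_pos)
  let ?P = "{(x, y). x \<noteq> y} :: ('b \<times> 'b) set"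
  show "compact (closure (T ` V))"
  proof (rule finite_net_imp_compact_closure_image)
    fix \<eta> :: real assume \<eta>: "\<eta> > 0"
    have "\<exists>V0. finite V0 \<and> V0 \<subseteq> V \<and> (\<forall>v\<in>V. \<exists>v0\<in>V0. \<forall>p\<in>?P. \<bar>\<psi> p v - \<psi> p v0\<bar> \<le> \<eta>)"
    proof (rule totally_bounded_transpose[OF _ _ \<eta>])
      show "\<bar>\<psi> p v\<bar> \<le> norm T * R" if v: "v \<in> V" and P: "p \<in> ?P" for p v
      proof -
        obtain x y where p: "p = (x, y)" "x \<noteq> y" using P by blast
        have "\<bar>\<psi> p v\<bar> \<le> norm (T v)"
          using cbeta_le_norm[of "T v"] unfolding p(1) T[OF p(2), symmetric] .
        also have "\<dots> \<le> norm T * norm v" by (rule norm_blinfun)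
        also have "\<dots> \<le> norm T * R" using R(2)[OF v] by (intro mult_left_mono) auto
        finally show ?thesis .
      qed
      fix \<theta> :: real assume "\<theta> > 0"
      \<comment> \<open>Dividing by \<open>R\<close> compensates for vectors of norm up to
        \<open>R\<close>.\<close>
      then have \<theta>R: "\<theta> / R > 0" using R(1) by simp
      then obtain P0 where P0: "finite P0" "P0 \<subseteq> ?P"
        "\<And>p. p \<in> ?P \<Longrightarrow> \<exists>p0\<in>P0. dist (\<psi> p) (\<psi> p0) \<le> \<theta> / R"
        by (rule compact_closure_image_finite_net[OF comp]) blast
      have "\<bar>\<psi> p v - \<psi> p0 v\<bar> \<le> \<theta>" if "v \<in> V" "dist (\<psi> p) (\<psi> p0) \<le> \<theta> / R" for p p0 v
      proof -
        have "\<bar>\<psi> p v - \<psi> p0 v\<bar> \<le> dist (\<psi> p) (\<psi> p0) * norm v"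
          using norm_blinfun[of "\<psi> p - \<psi> p0" v] by (simp add: dist_norm blinfun.diff_left)
        also have "\<dots> \<le> (\<theta> / R) * R"
          using that R less_imp_le[OF \<theta>R] by (intro mult_mono) auto
        finally show ?thesis using R(1) by simp
      qed
      then have "\<forall>p\<in>?P. \<exists>p0\<in>P0. \<forall>v\<in>V. \<bar>\<psi> p v - \<psi> p0 v\<bar> \<le> \<theta>"
      proof (intro ballI, goal_cases)
        case (1 p)
        show ?case using P0(3)[OF 1(2)] 1(1) by blast
      qed
      with P0(1,2) show "\<exists>P0. finite P0 \<and> P0 \<subseteq> ?P \<and> (\<forall>p\<in>?P. \<exists>p0\<in>P0. \<forall>v\<in>V. \<bar>\<psi> p v - \<psi> p0 v\<bar> \<le> \<theta>)"
        by (intro exI[of _ P0] conjI)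
    qed
    then obtain V0 where V0: "finite V0" "V0 \<subseteq> V"
      "\<forall>v\<in>V. \<exists>v0\<in>V0. \<forall>p\<in>?P. \<bar>\<psi> p v - \<psi> p v0\<bar> \<le> \<eta>"
      by (elim exE conjE) (rule that)
    have "dist (T v) (T v0) \<le> \<eta>" if "\<forall>p\<in>?P. \<bar>\<psi> p v - \<psi> p v0\<bar> \<le> \<eta>" for v v0
      unfolding dist_norm using that \<eta> by (intro norm_cbeta_le_dense) (auto simp: T)
    then have "\<forall>v\<in>V. \<exists>v0\<in>V0. dist (T v) (T v0) \<le> \<eta>"
    proof (intro ballI, goal_cases)
      case (1 v)
      show ?case using bspec[OF V0(3) 1(2)] 1(1) by blast
    qed
    with V0(1,2) show "\<exists>V0. finite V0 \<and> V0 \<subseteq> V \<and> (\<forall>v\<in>V. \<exists>v0\<in>V0. dist (T v) (T v0) \<le> \<eta>)"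
      by (intro exI[of _ V0] conjI)
  qed
qed

text \<open>A single \<open>T\<close> serves both claims: its construction does not refer to
  compactness, which it inherits from \<open>S\<close>.\<close>

lemma lip0_operator_extension:
  fixes S :: "'a::pointed_metric_space lip0 \<Rightarrow>\<^sub>L 'b::pointed_metric_space lip0"
  assumes "\<epsilon> > 0"
  obtains T :: "'a cbeta \<Rightarrow>\<^sub>L 'b cbeta" where "norm T \<le> norm S + \<epsilon>"
    "\<And>f. T (de_leeuw f) = de_leeuw (S f)"
    "compact_operator (blinfun_apply S) \<Longrightarrow> compact_operator (blinfun_apply T)"
proof -
  define J :: "'a lip0 \<Rightarrow>\<^sub>L 'a cbeta" where "J = Blinfun de_leeuw"
  have J: "J f = de_leeuw f" for f
    by (simp add: J_def bounded_linear_Blinfun_apply bounded_linear_de_leeuw)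
  \<comment> \<open>The adjoint of \<open>J\<close>, that is, restriction of functionals to
    Lipschitz functions.\<close>
  define q :: "('a cbeta \<Rightarrow>\<^sub>L real) \<Rightarrow>\<^sub>L ('a lip0 \<Rightarrow>\<^sub>L real)" where "q = Blinfun (\<lambda>\<mu>. \<mu> o\<^sub>L J)"
  have q: "q \<mu> = \<mu> o\<^sub>L J" for \<mu>
    unfolding q_def
    by (subst bounded_linear_Blinfun_apply)
      (rule bounded_bilinear.bounded_linear_left[OF bounded_bilinear_blinfun_compose], rule refl)
  have "\<exists>\<mu>. q \<mu> = \<phi> \<and> norm \<mu> \<le> norm \<phi>" for \<phi>
    by (rule hahn_banach_lift[of J \<phi>]) (auto simp: J norm_de_leeuw q)
  \<comment> \<open>No linearity of \<open>s\<close> is asserted; that of \<open>T\<close> rests on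
    each value \<open>s (m p)\<close> being a linear functional.\<close>
  then obtain s where s: "continuous_on UNIV s" "\<And>\<phi>. q (s \<phi>) = \<phi>" "\<And>\<phi>. norm (s \<phi>) \<le> norm \<phi> + \<epsilon>"
    by (rule bartle_graves[OF _ assms]) blast
  define m where "m p = molecule p o\<^sub>L S" for p
  have m_le: "norm (m p) \<le> norm S" for p
    using norm_blinfun_compose[of "molecule p" S] mult_right_mono[OF norm_molecule_le[of p] norm_ge_zero[of S]]
    by (simp add: m_def)
  have "continuous_on {(x, y). x \<noteq> y} m"
    unfolding m_def
    by (rule bounded_linear.continuous_on[OF bounded_bilinear.bounded_linear_left[OF bounded_bilinear_blinfun_compose]
      continuous_on_molecule])
  then have "continuous_on {(x, y). x \<noteq> y} (\<lambda>p. s (m p))"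
    by (rule continuous_on_compose2[OF s(1)]) simp
  moreover have "norm (s (m (x, y))) \<le> norm S + \<epsilon>" for x y
    using s(3)[of "m (x, y)"] m_le[of "(x, y)"] by simp
  moreover have "0 \<le> norm S + \<epsilon>" using assms by simp
  ultimately obtain T :: "'a cbeta \<Rightarrow>\<^sub>L 'b cbeta" where T: "norm T \<le> norm S + \<epsilon>"
    "\<And>G x y. x \<noteq> y \<Longrightarrow> T G (stone_cech_embed offdiag (x, y)) = s (m (x, y)) G"
    using operator_of_functionals[of "\<lambda>p. s (m p)" "norm S + \<epsilon>"] by blast
  show ?thesis
  proof (rule that[OF T(1)])
    fix f
    \<comment> \<open>On the de Leeuw image the lift \<open>s (m p)\<close> gives back
      \<open>m p\<close>.\<close>
    have "s (m p) (de_leeuw f) = m p f" for p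
      using s(2)[of "m p"] unfolding q J[symmetric] by (metis blinfun_apply_blinfun_compose)
    then show "T (de_leeuw f) = de_leeuw (S f)"
      by (intro cbeta_eqI_dense) (simp add: T(2) de_leeuw_embed m_def molecule_apply)
  next
    let ?P = "{(x, y). x \<noteq> y} :: ('b \<times> 'b) set"
    assume "compact_operator (blinfun_apply S)"
    then have "compact (closure (m ` ?P))"
      unfolding m_def by (rule compact_closure_molecules)
    \<comment> \<open>This image is compact, hence closed, so it contains the closure of the set of
      lifts.\<close>
    then have "compact (s ` closure (m ` ?P))"
      using s(1) continuous_on_subset by (blast intro: compact_continuous_image)
    moreover from this have "closure ((\<lambda>p. s (m p)) ` ?P) \<subseteq> s ` closure (m ` ?P)"
      using closure_subset[of "m ` ?P"] by (intro closure_minimal compact_imp_closed) blast+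
    ultimately have "compact (closure ((\<lambda>p. s (m p)) ` ?P))"
      using compact_Int_closed[OF _ closed_closure] by (metis inf.absorb2)
    then show "compact_operator (blinfun_apply T)"
      by (rule compact_operator_of_functionals[rotated]) (rule T(2))
  qed
qed

theorem theorem1:
  fixes S :: "'a::pointed_metric_space lip0 \<Rightarrow>\<^sub>L 'b::pointed_metric_space lip0"
    and \<epsilon> :: real
  assumes "\<epsilon> > 0"
  shows "(\<exists>T :: 'a cbeta \<Rightarrow>\<^sub>L 'b cbeta.
            norm T \<le> norm S + \<epsilon> \<and> (\<forall>f. blinfun_apply T (de_leeuw f) = de_leeuw (blinfun_apply S f)))
       \<and> (compact_operator (blinfun_apply S) \<longrightarrow>
          (\<exists>T :: 'a cbeta \<Rightarrow>\<^sub>L 'b cbeta. compact_operator (blinfun_apply T) \<and>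
            norm T \<le> norm S + \<epsilon> \<and> (\<forall>f. blinfun_apply T (de_leeuw f) = de_leeuw (blinfun_apply S f))))"
proof (rule lip0_operator_extension[OF assms, of S])
  fix T :: "'a cbeta \<Rightarrow>\<^sub>L 'b cbeta"
  assume "norm T \<le> norm S + \<epsilon>" "\<And>f. T (de_leeuw f) = de_leeuw (S f)"
    "compact_operator (blinfun_apply S) \<Longrightarrow> compact_operator (blinfun_apply T)"
  then show ?thesis by (intro conjI impI exI[of _ T] allI) simp_all
qed

end
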